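(* Let $V$ be a Komori variety. The cartesianization of the theory $\mathbb{L}oc_V^1$ is the theory $\mathbb{T}_V$.
   Context: An MV-algebra is a structure $(A,\oplus,\neg,0)$ such that $(A,\oplus,0)$ is a commutative monoid, $\neg\neg x=x$, $x\oplus\neg 0=\neg 0$ and $\neg(\neg x\oplus y)\oplus y=\neg(\neg y\oplus x)\oplus x$. Write $1=\neg 0$, $x\odot y=\neg(\neg x\oplus\neg y)$, $kx=x\oplus\cdots\oplus x$ and $x^k=x\odot\cdots\odot x$ ($k$ times). $\mathbb{MV}$ is the algebraic theory of MV-algebras. For a lattice-ordered abelian group $G$ and $u\ge 0$ in $G$, $\Gamma(G,u)$ is the MV-algebra on $[0,u]$ with $x\oplus y=\inf(x+y,u)$, $\neg x=u-x$. For $m\ge 1$, $S_m=\Gamma(\mathbb{Z},m)$ and $S_m^\omega=\Gamma(\mathbb{Z}\times_{\mathrm{lex}}\mathbb{Z},(m,0))$. A Komori variety is a variety $V=V(\{S_i\}_{i\in I},\{S_j^\omega\}_{j\in J})$ generated by these algebras, with $I,J$ finite sets of positive integers, not both empty. Put $n=\mathrm{l.c.m.}(I\cup J)$, which depends only on $V$. $\mathbb{T}_V$ is the algebraic theory axiomatizing $V$: the axioms of $\mathbb{MV}$ plus, with $N=\max(I\cup J)$, the sequents (for all $x$): $((N+1)x^N)^2=2x^{N+1}$; $(px^{p-1})^{N+1}=(N+1)x^p$ for every $1<p<N$ dividing no element of $I\cup J$; $(N+1)x^q=(N+2)x^q$ for every $q$ which divides some $i\in I$ but no $j\in J$; and $((n+1)x^n)^2=2x^{n+1}$.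 $\mathbb{L}oc_V^1$ is the geometric theory obtained from $\mathbb{T}_V$ by adding $\sigma_n:(\top\vdash_x((n+1)x)^2=0\vee(n+1)x=1)$ and $(0=1\vdash\bot)$. A cartesian formula relative to a geometric theory $\mathbb{T}$ is one built from atomic formulae using only finitary conjunctions and $\mathbb{T}$-provably unique existential quantifications; a cartesian sequent relative to $\mathbb{T}$ is a sequent between cartesian formulae relative to $\mathbb{T}$. The cartesianization of $\mathbb{T}$ is the cartesian theory consisting of all cartesian sequents over the signature of $\mathbb{T}$ which are provable in $\mathbb{T}$ (in geometric logic). Theories are identified when they prove the same sequents. *)

theory Defs
  imports
    Main
    "HOL-Library.Lattice_Algebras"
    "HOL-Library.Product_Lexorder"
    "HOL-Library.Product_Plus"
begin

section \<open>Geometric logic over the signature of MV-algebras\<close>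

text \<open>
  Variables are de Bruijn indices and a context is a natural number \<open>n\<close>, standing for
  the variables \<open>Var 0, \<dots>, Var (n - 1)\<close>.
\<close>

datatype mv_term =
    Var nat
  | Zero
  | Neg mv_term
  | Plus mv_term mv_term

text \<open>
  The only atomic formulae are equations, since the signature has no relation symbols.
  \<open>Ex\<close> binds \<open>Var 0\<close>.  \<open>Disj f\<close> is the infinitary disjunction of the family \<open>f\<close>; every
  nonempty family indexed by a set that embeds into \<open>'i\<close> can be reindexed by \<open>'i\<close> with
  repetitions.  The type \<open>'i\<close> only bounds the size of disjunctions and is arbitrary.
\<close>

datatype 'i geom_fm =
    Eq mv_term mv_term
  | Top
  | And "'i geom_fm" "'i geom_fm"
  | Bot
  | Or "'i geom_fm" "'i geom_fm"
  | Disj "'i \<Rightarrow> 'i geom_fm"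
  | Ex "'i geom_fm"

primrec term_in_ctxt :: "nat \<Rightarrow> mv_term \<Rightarrow> bool" where
  "term_in_ctxt n (Var i) \<longleftrightarrow> i < n"
| "term_in_ctxt n Zero \<longleftrightarrow> True"
| "term_in_ctxt n (Neg t) \<longleftrightarrow> term_in_ctxt n t"
| "term_in_ctxt n (Plus s t) \<longleftrightarrow> term_in_ctxt n s \<and> term_in_ctxt n t"

text \<open>
  Formulae-in-context.  As in the usual definition of geometric formulae, an infinitary
  disjunction only has finitely many free variables: all its members live in one context.
\<close>

primrec fm_in_ctxt :: "nat \<Rightarrow> 'i geom_fm \<Rightarrow> bool" where
  "fm_in_ctxt n (Eq s t) \<longleftrightarrow> term_in_ctxt n s \<and> term_in_ctxt n t"
| "fm_in_ctxt n Top \<longleftrightarrow> True"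
| "fm_in_ctxt n (And \<phi> \<psi>) \<longleftrightarrow> fm_in_ctxt n \<phi> \<and> fm_in_ctxt n \<psi>"
| "fm_in_ctxt n Bot \<longleftrightarrow> True"
| "fm_in_ctxt n (Or \<phi> \<psi>) \<longleftrightarrow> fm_in_ctxt n \<phi> \<and> fm_in_ctxt n \<psi>"
| "fm_in_ctxt n (Disj f) \<longleftrightarrow> (\<forall>i. fm_in_ctxt n (f i))"
| "fm_in_ctxt n (Ex \<phi>) \<longleftrightarrow> fm_in_ctxt (Suc n) \<phi>"

primrec subst_term :: "(nat \<Rightarrow> mv_term) \<Rightarrow> mv_term \<Rightarrow> mv_term" where
  "subst_term \<sigma> (Var i) = \<sigma> i"
| "subst_term \<sigma> Zero = Zero"
| "subst_term \<sigma> (Neg t) = Neg (subst_term \<sigma> t)"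
| "subst_term \<sigma> (Plus s t) = Plus (subst_term \<sigma> s) (subst_term \<sigma> t)"

definition lift_subst :: "(nat \<Rightarrow> mv_term) \<Rightarrow> nat \<Rightarrow> mv_term" where
  "lift_subst \<sigma> i =
    (case i of 0 \<Rightarrow> Var 0 | Suc j \<Rightarrow> subst_term (\<lambda>k. Var (Suc k)) (\<sigma> j))"

primrec subst_fm :: "(nat \<Rightarrow> mv_term) \<Rightarrow> 'i geom_fm \<Rightarrow> 'i geom_fm" where
  "subst_fm \<sigma> (Eq s t) = Eq (subst_term \<sigma> s) (subst_term \<sigma> t)"
| "subst_fm \<sigma> Top = Top"
| "subst_fm \<sigma> (And \<phi> \<psi>) = And (subst_fm \<sigma> \<phi>) (subst_fm \<sigma> \<psi>)"
| "subst_fm \<sigma> Bot = Bot"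
| "subst_fm \<sigma> (Or \<phi> \<psi>) = Or (subst_fm \<sigma> \<phi>) (subst_fm \<sigma> \<psi>)"
| "subst_fm \<sigma> (Disj f) = Disj (\<lambda>i. subst_fm \<sigma> (f i))"
| "subst_fm \<sigma> (Ex \<phi>) = Ex (subst_fm (lift_subst \<sigma>) \<phi>)"

definition weaken_fm :: "'i geom_fm \<Rightarrow> 'i geom_fm" where
  "weaken_fm \<phi> = subst_fm (\<lambda>i. Var (Suc i)) \<phi>"

datatype 'i sequent =
  Sequent "'i geom_fm" nat "'i geom_fm"  ("_ \<turnstile>[_] _" [51, 0, 51] 50)

primrec sequent_wf :: "'i sequent \<Rightarrow> bool" where
  "sequent_wf (\<phi> \<turnstile>[n] \<psi>) \<longleftrightarrow> fm_in_ctxt n \<phi> \<and> fm_in_ctxt n \<psi>"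

type_synonym 'i geom_theory = "'i sequent set"

text \<open>
  The sequent calculus of geometric logic: structural rules, equality, finite conjunctions,
  finite and infinitary disjunctions, existential quantification, the distributive laws and
  the Frobenius law.
\<close>

inductive derives :: "'i geom_theory \<Rightarrow> 'i sequent \<Rightarrow> bool" (infix "\<tturnstile>" 40)
  for T :: "'i geom_theory" where
  ax: "s \<in> T \<Longrightarrow> sequent_wf s \<Longrightarrow> T \<tturnstile> s"
| ident: "fm_in_ctxt n \<phi> \<Longrightarrow> T \<tturnstile> (\<phi> \<turnstile>[n] \<phi>)"
| substitution: "T \<tturnstile> (\<phi> \<turnstile>[n] \<psi>) \<Longrightarrow> (\<And>i. i < n \<Longrightarrow> term_in_ctxt m (\<sigma> i)) \<Longrightarrow>
    T \<tturnstile> (subst_fm \<sigma> \<phi> \<turnstile>[m] subst_fm \<sigma> \<psi>)"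
| cut: "T \<tturnstile> (\<phi> \<turnstile>[n] \<psi>) \<Longrightarrow> T \<tturnstile> (\<psi> \<turnstile>[n] \<chi>) \<Longrightarrow> T \<tturnstile> (\<phi> \<turnstile>[n] \<chi>)"
| eq_refl: "i < n \<Longrightarrow> T \<tturnstile> (Top \<turnstile>[n] Eq (Var i) (Var i))"
| eq_subst: "i < n \<Longrightarrow> j < n \<Longrightarrow> fm_in_ctxt n \<phi> \<Longrightarrow>
    T \<tturnstile> (And (Eq (Var i) (Var j)) \<phi> \<turnstile>[n] subst_fm (Var(i := Var j)) \<phi>)"
| top_right: "fm_in_ctxt n \<phi> \<Longrightarrow> T \<tturnstile> (\<phi> \<turnstile>[n] Top)"
| and_left1: "fm_in_ctxt n \<phi> \<Longrightarrow> fm_in_ctxt n \<psi> \<Longrightarrow> T \<tturnstile> (And \<phi> \<psi> \<turnstile>[n] \<phi>)"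
| and_left2: "fm_in_ctxt n \<phi> \<Longrightarrow> fm_in_ctxt n \<psi> \<Longrightarrow> T \<tturnstile> (And \<phi> \<psi> \<turnstile>[n] \<psi>)"
| and_right: "T \<tturnstile> (\<phi> \<turnstile>[n] \<psi>) \<Longrightarrow> T \<tturnstile> (\<phi> \<turnstile>[n] \<chi>) \<Longrightarrow> T \<tturnstile> (\<phi> \<turnstile>[n] And \<psi> \<chi>)"
| bot_left: "fm_in_ctxt n \<phi> \<Longrightarrow> T \<tturnstile> (Bot \<turnstile>[n] \<phi>)"
| or_right1: "fm_in_ctxt n \<phi> \<Longrightarrow> fm_in_ctxt n \<psi> \<Longrightarrow> T \<tturnstile> (\<phi> \<turnstile>[n] Or \<phi> \<psi>)"
| or_right2: "fm_in_ctxt n \<phi> \<Longrightarrow> fm_in_ctxt n \<psi> \<Longrightarrow> T \<tturnstile> (\<psi> \<turnstile>[n] Or \<phi> \<psi>)"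
| or_left: "T \<tturnstile> (\<phi> \<turnstile>[n] \<chi>) \<Longrightarrow> T \<tturnstile> (\<psi> \<turnstile>[n] \<chi>) \<Longrightarrow> T \<tturnstile> (Or \<phi> \<psi> \<turnstile>[n] \<chi>)"
| disj_right: "fm_in_ctxt n (Disj f) \<Longrightarrow> T \<tturnstile> (f i \<turnstile>[n] Disj f)"
| disj_left: "(\<And>i. T \<tturnstile> (f i \<turnstile>[n] \<chi>)) \<Longrightarrow> T \<tturnstile> (Disj f \<turnstile>[n] \<chi>)"
| ex_left: "T \<tturnstile> (\<phi> \<turnstile>[Suc n] weaken_fm \<psi>) \<Longrightarrow> fm_in_ctxt n \<psi> \<Longrightarrow> T \<tturnstile> (Ex \<phi> \<turnstile>[n] \<psi>)"
| ex_left_inv: "T \<tturnstile> (Ex \<phi> \<turnstile>[n] \<psi>) \<Longrightarrow> T \<tturnstile> (\<phi> \<turnstile>[Suc n] weaken_fm \<psi>)"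
| distrib_or: "fm_in_ctxt n \<phi> \<Longrightarrow> fm_in_ctxt n \<psi> \<Longrightarrow> fm_in_ctxt n \<chi> \<Longrightarrow>
    T \<tturnstile> (And \<phi> (Or \<psi> \<chi>) \<turnstile>[n] Or (And \<phi> \<psi>) (And \<phi> \<chi>))"
| distrib_disj: "fm_in_ctxt n \<phi> \<Longrightarrow> fm_in_ctxt n (Disj f) \<Longrightarrow>
    T \<tturnstile> (And \<phi> (Disj f) \<turnstile>[n] Disj (\<lambda>i. And \<phi> (f i)))"
| frobenius: "fm_in_ctxt n \<phi> \<Longrightarrow> fm_in_ctxt (Suc n) \<psi> \<Longrightarrow>
    T \<tturnstile> (And \<phi> (Ex \<psi>) \<turnstile>[n] Ex (And (weaken_fm \<phi>) \<psi>))"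

definition theory_equiv :: "'i geom_theory \<Rightarrow> 'i geom_theory \<Rightarrow> bool" where
  "theory_equiv T T' \<longleftrightarrow> (\<forall>s. (T \<tturnstile> s) \<longleftrightarrow> (T' \<tturnstile> s))"


section \<open>Cartesianization\<close>

text \<open>
  If \<open>\<phi>(y, x)\<close> lives in context \<open>Suc n\<close>, with \<open>y = Var 0\<close>, its two copies below live in the
  context \<open>y = Var 0\<close>, \<open>y' = Var 1\<close>, \<open>x = Var 2, Var 3, \<dots>\<close>; the first is \<open>\<phi>(y, x)\<close>, the
  second is \<open>\<phi>(y', x)\<close>.
\<close>

definition unique_sequent :: "nat \<Rightarrow> 'i geom_fm \<Rightarrow> 'i sequent" where
  "unique_sequent n \<phi> =
    (And (subst_fm (\<lambda>i. case i of 0 \<Rightarrow> Var 0 | Suc j \<Rightarrow> Var (Suc (Suc j))) \<phi>)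
         (subst_fm (\<lambda>i. Var (Suc i)) \<phi>)
     \<turnstile>[Suc (Suc n)] Eq (Var 0) (Var 1))"

inductive cartesian_fm :: "'i geom_theory \<Rightarrow> nat \<Rightarrow> 'i geom_fm \<Rightarrow> bool"
  for T :: "'i geom_theory" where
  "term_in_ctxt n s \<Longrightarrow> term_in_ctxt n t \<Longrightarrow> cartesian_fm T n (Eq s t)"
| "cartesian_fm T n Top"
| "cartesian_fm T n \<phi> \<Longrightarrow> cartesian_fm T n \<psi> \<Longrightarrow> cartesian_fm T n (And \<phi> \<psi>)"
| "cartesian_fm T (Suc n) \<phi> \<Longrightarrow> T \<tturnstile> unique_sequent n \<phi> \<Longrightarrow> cartesian_fm T n (Ex \<phi>)"

primrec cartesian_sequent :: "'i geom_theory \<Rightarrow> 'i sequent \<Rightarrow> bool" where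
  "cartesian_sequent T (\<phi> \<turnstile>[n] \<psi>) \<longleftrightarrow> cartesian_fm T n \<phi> \<and> cartesian_fm T n \<psi>"

definition cartesianization :: "'i geom_theory \<Rightarrow> 'i geom_theory" where
  "cartesianization T = {s. cartesian_sequent T s \<and> (T \<tturnstile> s)}"


section \<open>MV-algebras and Komori varieties\<close>

record 'a mv_structure =
  mv_carrier :: "'a set"
  mv_zero :: 'a
  mv_neg :: "'a \<Rightarrow> 'a"
  mv_plus :: "'a \<Rightarrow> 'a \<Rightarrow> 'a"

definition mv_algebra :: "'a mv_structure \<Rightarrow> bool" where
  "mv_algebra A \<longleftrightarrow>
    mv_zero A \<in> mv_carrier A \<and>
    (\<forall>x\<in>mv_carrier A. mv_neg A x \<in> mv_carrier A) \<and>
    (\<forall>x\<in>mv_carrier A. \<forall>y\<in>mv_carrier A. mv_plus A x y \<in> mv_carrier A) \<and>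
    (\<forall>x\<in>mv_carrier A. \<forall>y\<in>mv_carrier A. \<forall>z\<in>mv_carrier A.
      mv_plus A (mv_plus A x y) z = mv_plus A x (mv_plus A y z)) \<and>
    (\<forall>x\<in>mv_carrier A. \<forall>y\<in>mv_carrier A. mv_plus A x y = mv_plus A y x) \<and>
    (\<forall>x\<in>mv_carrier A. mv_plus A x (mv_zero A) = x) \<and>
    (\<forall>x\<in>mv_carrier A. mv_neg A (mv_neg A x) = x) \<and>
    (\<forall>x\<in>mv_carrier A. mv_plus A x (mv_neg A (mv_zero A)) = mv_neg A (mv_zero A)) \<and>
    (\<forall>x\<in>mv_carrier A. \<forall>y\<in>mv_carrier A.
      mv_plus A (mv_neg A (mv_plus A (mv_neg A x) y)) y =
      mv_plus A (mv_neg A (mv_plus A (mv_neg A y) x)) x)"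

primrec mv_eval :: "'a mv_structure \<Rightarrow> (nat \<Rightarrow> 'a) \<Rightarrow> mv_term \<Rightarrow> 'a" where
  "mv_eval A v (Var i) = v i"
| "mv_eval A v Zero = mv_zero A"
| "mv_eval A v (Neg t) = mv_neg A (mv_eval A v t)"
| "mv_eval A v (Plus s t) = mv_plus A (mv_eval A v s) (mv_eval A v t)"

definition satisfies_identity :: "'a mv_structure \<Rightarrow> mv_term \<Rightarrow> mv_term \<Rightarrow> bool" where
  "satisfies_identity A s t \<longleftrightarrow>
    (\<forall>v. range v \<subseteq> mv_carrier A \<longrightarrow> mv_eval A v s = mv_eval A v t)"

definition Gamma :: "'a::lattice_ab_group_add \<Rightarrow> 'a mv_structure" where
  "Gamma u = \<lparr>mv_carrier = {0..u}, mv_zero = 0, mv_neg = (\<lambda>x. u - x),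
              mv_plus = (\<lambda>x y. inf (x + y) u)\<rparr>"

text \<open>With the order of \<^theory>\<open>HOL-Library.Product_Lexorder\<close>, this is the lexicographic product.\<close>

instance prod :: (linordered_ab_group_add, linordered_ab_group_add) lattice_ab_group_add
  by standard (auto simp: less_eq_prod_def)

definition S_fin :: "nat \<Rightarrow> int mv_structure" where
  "S_fin m = Gamma (int m)"

definition S_omega :: "nat \<Rightarrow> (int \<times> int) mv_structure" where
  "S_omega m = Gamma (int m, 0)"

text \<open>
  The variety generated by \<open>S_fin i\<close> (\<open>i \<in> I\<close>) and \<open>S_omega j\<close> (\<open>j \<in> J\<close>), i.e. the least
  equational class containing them, restricted to algebras whose carrier is a subset of \<open>'a\<close>.
\<close>

definition Komori_variety :: "nat set \<Rightarrow> nat set \<Rightarrow> 'a mv_structure set" where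
  "Komori_variety I J = {A. mv_algebra A \<and>
    (\<forall>s t. (\<forall>i\<in>I. satisfies_identity (S_fin i) s t) \<and>
           (\<forall>j\<in>J. satisfies_identity (S_omega j) s t) \<longrightarrow> satisfies_identity A s t)}"


section \<open>The theories\<close>

abbreviation One :: mv_term where
  "One \<equiv> Neg Zero"

definition Times :: "mv_term \<Rightarrow> mv_term \<Rightarrow> mv_term" where
  "Times s t = Neg (Plus (Neg s) (Neg t))"

text \<open>
  The \<open>k\<close>-fold sum is built as \<open>x \<oplus> (\<dots> \<oplus> (x \<oplus> 0))\<close>, and the \<open>k\<close>-fold product dually;
  by the monoid axioms this only fixes the harmless conventions \<open>0x = 0\<close> and \<open>x\<^sup>0 = 1\<close>.
\<close>

primrec multiple :: "nat \<Rightarrow> mv_term \<Rightarrow> mv_term" where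
  "multiple 0 t = Zero"
| "multiple (Suc k) t = Plus t (multiple k t)"

primrec power_term :: "mv_term \<Rightarrow> nat \<Rightarrow> mv_term" where
  "power_term t 0 = One"
| "power_term t (Suc k) = Times t (power_term t k)"

definition MV_theory :: "'i geom_theory" where
  "MV_theory = (let x = Var 0; y = Var 1; z = Var 2 in
    {Top \<turnstile>[3] Eq (Plus (Plus x y) z) (Plus x (Plus y z)),
     Top \<turnstile>[2] Eq (Plus x y) (Plus y x),
     Top \<turnstile>[1] Eq (Plus x Zero) x,
     Top \<turnstile>[1] Eq (Neg (Neg x)) x,
     Top \<turnstile>[1] Eq (Plus x One) One,
     Top \<turnstile>[2] Eq (Plus (Neg (Plus (Neg x) y)) y) (Plus (Neg (Plus (Neg y) x)) x)})"

text \<open>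
  \<open>TV_theory I J\<close> is the theory of the variety \<open>Komori_variety I J\<close>, written with the axioms
  attached to the given generators.
\<close>

definition TV_theory :: "nat set \<Rightarrow> nat set \<Rightarrow> 'i geom_theory" where
  "TV_theory I J = (let x = Var 0; N = Max (I \<union> J); n = Lcm (I \<union> J) in
    MV_theory \<union>
    {Top \<turnstile>[1] Eq (power_term (multiple (N + 1) (power_term x N)) 2)
                  (multiple 2 (power_term x (N + 1)))} \<union>
    {Top \<turnstile>[1] Eq (power_term (multiple p (power_term x (p - 1))) (N + 1))
                  (multiple (N + 1) (power_term x p)) | p.
       1 < p \<and> p < N \<and> (\<forall>k\<in>I \<union> J. \<not> p dvd k)} \<union>
    {Top \<turnstile>[1] Eq (multiple (N + 1) (power_term x q)) (multiple (N + 2) (power_term x q)) | q.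
       (\<exists>i\<in>I. q dvd i) \<and> (\<forall>j\<in>J. \<not> q dvd j)} \<union>
    {Top \<turnstile>[1] Eq (power_term (multiple (n + 1) (power_term x n)) 2)
                  (multiple 2 (power_term x (n + 1)))})"

definition Loc1_theory :: "nat set \<Rightarrow> nat set \<Rightarrow> 'i geom_theory" where
  "Loc1_theory I J = (let x = Var 0; n = Lcm (I \<union> J) in
    TV_theory I J \<union>
    {Top \<turnstile>[1] Or (Eq (power_term (multiple (n + 1) x) 2) Zero) (Eq (multiple (n + 1) x) One),
     Eq Zero One \<turnstile>[0] Bot})"

end

theory Submission
  imports Defs
begin

text \<open>
  Write \<open>n\<close> for the least common multiple of \<open>I \<union> J\<close>.  The point is that \<open>\<sigma>\<^sub>n\<close> only asks a question
  about Boolean elements.  In an algebra of the variety, \<open>e = ((n + 1)x)\<^sup>2\<close> satisfies \<open>e \<oplus> e = e\<close>, so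
  it splits the algebra into a factor where \<open>e = 0\<close> and a factor where \<open>e = 1\<close>, and in the second one
  \<open>(n + 1)x = 1\<close>.  Hence every algebra of the variety is local in the sense of \<open>\<sigma>\<^sub>n\<close> after a finite
  Boolean splitting, and a statement that can be glued along such splittings and holds in all local
  algebras holds in the whole variety.

  That \<open>e\<close> is Boolean comes from the axiom \<open>((n + 1)x\<^sup>n)\<^sup>2 = 2x\<^sup>n\<^sup>+\<^sup>1\<close> at \<open>\<not>x\<close>
  (\<open>boolean_of_axiom\<close>): with \<open>a = (n + 1)x\<close> and \<open>b = (n + 1)\<not>(nx)\<close> it says \<open>b\<^sup>2 = \<not>a\<^sup>2\<close>, while
  \<open>a \<or> b = 1\<close> and therefore \<open>a\<^sup>2 \<or> b\<^sup>2 = 1\<close> in every MV-algebra.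

  The gluing is made precise by a forcing semantics for all geometric formulae (\<open>forces\<close>).  The
  worlds are the idempotents \<open>c\<close> of an MV-algebra \<open>A\<close>, thought of as the quotients \<open>A/c\<close>, and a
  disjunction is forced when it holds after finitely many Boolean splittings.  Existential
  quantifiers are interpreted by actual elements of \<open>A\<close>: witnesses chosen on the two sides of a
  splitting glue to one element (\<open>element_glue\<close>).  So forcing agrees with truth in \<open>A\<close> for regular
  formulae, which include all cartesian ones.  Geometric logic is sound for forcing
  (\<open>derives_valid\<close>), and algebras of the variety force \<open>\<sigma>\<^sub>n\<close> and non-triviality
  (\<open>Loc1_theory_valid\<close>); the trivial algebra causes no conflict because \<open>\<bottom>\<close> is
  forced at the world of the trivial quotient.

  To return from truth to provability in \<open>TV_theory I J\<close>, this is applied to algebras of terms modulo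
  provable equality under a hypothesis \<open>\<chi>\<close> in a finite context (\<open>term_algebra\<close>).  Witnesses for
  the existential quantifiers of an antecedent are adjoined by passing to a larger context and a
  stronger hypothesis (\<open>derives_by_realizing\<close>).  The outcome is \<open>regular_conservativity\<close>: a regular
  sequent provable in the local theory is already provable in the theory of the variety.  Conversely,
  the axioms of the latter are cartesian sequents belonging to the former.
\<close>

section \<open>Substitution and derived rules\<close>

lemma subst_term_comp: "subst_term \<tau> (subst_term \<sigma> t) = subst_term (\<lambda>i. subst_term \<tau> (\<sigma> i)) t"
  by (induction t) auto

lemma lift_subst_simps [simp]:
  "lift_subst \<sigma> 0 = Var 0"
  "lift_subst \<sigma> (Suc j) = subst_term (\<lambda>k. Var (Suc k)) (\<sigma> j)"
  by (simp_all add: lift_subst_def)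

lemma lift_subst_comp:
  "subst_term (lift_subst \<tau>) (lift_subst \<sigma> i) = lift_subst (\<lambda>i. subst_term \<tau> (\<sigma> i)) i"
  by (cases i) (simp_all add: subst_term_comp)

lemma subst_fm_comp: "subst_fm \<tau> (subst_fm \<sigma> \<phi>) = subst_fm (\<lambda>i. subst_term \<tau> (\<sigma> i)) \<phi>"
  by (induction \<phi> arbitrary: \<sigma> \<tau>) (auto simp: subst_term_comp lift_subst_comp)

lemma subst_term_id: "term_in_ctxt n t \<Longrightarrow> (\<And>i. i < n \<Longrightarrow> \<sigma> i = Var i) \<Longrightarrow> subst_term \<sigma> t = t"
  by (induction t) auto

lemma subst_fm_id: "fm_in_ctxt n \<phi> \<Longrightarrow> (\<And>i. i < n \<Longrightarrow> \<sigma> i = Var i) \<Longrightarrow> subst_fm \<sigma> \<phi> = \<phi>"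
proof (induction \<phi> arbitrary: n \<sigma>)
  case (Ex \<phi>)
  have "lift_subst \<sigma> i = Var i" if "i < Suc n" for i
    using that Ex.prems(2) by (cases i) auto
  then show ?case using Ex by auto
qed (auto simp: subst_term_id, blast)

lemma subst_term_ctxt:
  "term_in_ctxt n t \<Longrightarrow> (\<And>i. i < n \<Longrightarrow> term_in_ctxt m (\<sigma> i)) \<Longrightarrow> term_in_ctxt m (subst_term \<sigma> t)"
  by (induction t) auto

lemma shift_term_ctxt: "term_in_ctxt n t \<Longrightarrow> term_in_ctxt (Suc n) (subst_term (\<lambda>k. Var (Suc k)) t)"
  by (rule subst_term_ctxt) auto

lemma subst_fm_ctxt:
  "fm_in_ctxt n \<phi> \<Longrightarrow> (\<And>i. i < n \<Longrightarrow> term_in_ctxt m (\<sigma> i)) \<Longrightarrow> fm_in_ctxt m (subst_fm \<sigma> \<phi>)"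
proof (induction \<phi> arbitrary: n m \<sigma>)
  case (Ex \<phi>)
  have "term_in_ctxt (Suc m) (lift_subst \<sigma> i)" if "i < Suc n" for i
    using that Ex.prems(2) by (cases i) (auto simp: shift_term_ctxt)
  then show ?case using Ex by auto
qed (auto simp: subst_term_ctxt, blast)

lemma weaken_fm_ctxt: "fm_in_ctxt n \<phi> \<Longrightarrow> fm_in_ctxt (Suc n) (weaken_fm \<phi>)"
  unfolding weaken_fm_def by (rule subst_fm_ctxt) auto

lemma subst_weaken: "subst_fm \<sigma> (weaken_fm \<phi>) = subst_fm (\<lambda>i. \<sigma> (Suc i)) \<phi>"
  by (simp add: weaken_fm_def subst_fm_comp)

lemma subst_lift_case:
  "subst_fm (case_nat t Var) (subst_fm (lift_subst \<sigma>) \<phi>) = subst_fm (case_nat t \<sigma>) \<phi>"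
proof -
  have "subst_term (case_nat t Var) (lift_subst \<sigma> i) = case_nat t \<sigma> i" for i
  proof (cases i)
    case (Suc j)
    have "subst_term (\<lambda>k. Var k) s = s" for s by (induction s) auto
    then show ?thesis by (simp add: Suc subst_term_comp)
  qed simp
  then show ?thesis by (simp add: subst_fm_comp)
qed

lemma derives_wf: "T \<tturnstile> s \<Longrightarrow> sequent_wf s"
proof (induction rule: derives.induct)
  case (substitution \<phi> n \<psi> m \<sigma>)
  then show ?case by (auto intro: subst_fm_ctxt)
next
  case (eq_subst i n j \<phi>)
  then show ?case by (auto intro: subst_fm_ctxt)
next
  case (ex_left_inv \<phi> n \<psi>)
  then show ?case by (auto intro: weaken_fm_ctxt)
next
  case (frobenius n \<phi> \<psi>)
  then show ?case by (auto intro: weaken_fm_ctxt)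
qed auto

lemma derives_trans:
  assumes "\<And>s. s \<in> T \<Longrightarrow> T' \<tturnstile> s" and "T \<tturnstile> s"
  shows "T' \<tturnstile> s"
  using assms(2) by (induction) (auto intro: assms(1) derives.intros)

lemma derives_refl:
  assumes "term_in_ctxt m t" "fm_in_ctxt m \<chi>"
  shows "T \<tturnstile> (\<chi> \<turnstile>[m] Eq t t)"
proof -
  have "T \<tturnstile> (subst_fm (\<lambda>_. t) Top \<turnstile>[m] subst_fm (\<lambda>_. t) (Eq (Var 0) (Var 0)))"
    by (rule substitution[OF eq_refl[of 0 "Suc 0"]]) (use assms in auto)
  then show ?thesis using cut[OF top_right] assms by auto
qed

text \<open>
  The equality rule of the calculus replaces a variable by a variable in a formula.  Substituting
  \<open>s\<close> and \<open>t\<close> for two fresh variables turns it into the replacement of \<open>s\<close> by \<open>t\<close> in an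
  equation, where \<open>Var 0\<close> marks the occurrences to be replaced.  Symmetry, transitivity and
  congruence of provable equality are the instances below.
\<close>

lemma derives_leibniz:
  assumes st: "T \<tturnstile> (\<chi> \<turnstile>[m] Eq s t)"
    and ab: "T \<tturnstile> (\<chi> \<turnstile>[m] Eq (subst_term (case_nat s Var) a) (subst_term (case_nat s Var) b))"
    and ctxt: "term_in_ctxt (Suc m) a" "term_in_ctxt (Suc m) b"
  shows "T \<tturnstile> (\<chi> \<turnstile>[m] Eq (subst_term (case_nat t Var) a) (subst_term (case_nat t Var) b))"
proof -
  let ?u = "\<lambda>i. case i of 0 \<Rightarrow> Var 0 | Suc j \<Rightarrow> Var (Suc (Suc j))"
  let ?\<phi> = "Eq (subst_term ?u a) (subst_term ?u b)"
  let ?\<sigma> = "case_nat s (case_nat t Var)"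
  have wf: "term_in_ctxt m s" "term_in_ctxt m t" "fm_in_ctxt m \<chi>"
    using derives_wf[OF st] by auto
  have "T \<tturnstile> (subst_fm ?\<sigma> (And (Eq (Var 0) (Var 1)) ?\<phi>) \<turnstile>[m] subst_fm ?\<sigma> (subst_fm (Var(0 := Var 1)) ?\<phi>))"
    by (rule substitution[OF eq_subst[of 0 "Suc (Suc m)" 1]])
      (use ctxt wf in \<open>auto intro!: subst_term_ctxt[of "Suc m"] split: nat.splits\<close>)
  moreover have "(\<lambda>i. subst_term ?\<sigma> (?u i)) = case_nat s Var"
    "(\<lambda>i. subst_term ?\<sigma> (subst_term (Var(0 := Var 1)) (?u i))) = case_nat t Var"
    by (auto simp: fun_eq_iff split: nat.splits)
  ultimately have "T \<tturnstile> (And (Eq s t) (Eq (subst_term (case_nat s Var) a) (subst_term (case_nat s Var) b))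
      \<turnstile>[m] Eq (subst_term (case_nat t Var) a) (subst_term (case_nat t Var) b))"
    by (simp add: subst_term_comp)
  then show ?thesis by (rule cut[OF and_right[OF st ab]])
qed

lemma subst_shift [simp]: "subst_term (case_nat s Var) (subst_term (\<lambda>k. Var (Suc k)) t) = t"
proof -
  have "subst_term (\<lambda>k. Var k) t = t" by (induction t) auto
  then show ?thesis by (simp add: subst_term_comp)
qed

lemma derives_sym:
  assumes "T \<tturnstile> (\<chi> \<turnstile>[m] Eq s t)"
  shows "T \<tturnstile> (\<chi> \<turnstile>[m] Eq t s)"
proof -
  let ?up = "subst_term (\<lambda>k. Var (Suc k))"
  have wf: "term_in_ctxt m s" "fm_in_ctxt m \<chi>"
    using derives_wf[OF assms] by auto
  show ?thesis
    using derives_leibniz[OF assms, of "Var 0" "?up s"] wf derives_refl[of m s "\<chi>" T]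
    by (simp add: shift_term_ctxt)
qed

lemma derives_eq_trans:
  assumes "T \<tturnstile> (\<chi> \<turnstile>[m] Eq r s)" "T \<tturnstile> (\<chi> \<turnstile>[m] Eq s t)"
  shows "T \<tturnstile> (\<chi> \<turnstile>[m] Eq r t)"
proof -
  have wf: "term_in_ctxt m r" "fm_in_ctxt m \<chi>"
    using derives_wf[OF assms(1)] by auto
  show ?thesis
    using derives_leibniz[OF assms(2), of "subst_term (\<lambda>k. Var (Suc k)) r" "Var 0"] assms wf
    by (simp add: shift_term_ctxt)
qed

lemma derives_neg:
  assumes "T \<tturnstile> (\<chi> \<turnstile>[m] Eq s t)"
  shows "T \<tturnstile> (\<chi> \<turnstile>[m] Eq (Neg s) (Neg t))"
proof -
  have wf: "term_in_ctxt m s" "fm_in_ctxt m \<chi>"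
    using derives_wf[OF assms] by auto
  show ?thesis
    using derives_leibniz[OF assms, of "Neg (subst_term (\<lambda>k. Var (Suc k)) s)" "Neg (Var 0)"] wf
      derives_refl[of m "Neg s" "\<chi>" T]
    by (simp add: shift_term_ctxt)
qed

lemma derives_plus:
  assumes "T \<tturnstile> (\<chi> \<turnstile>[m] Eq s t)" "T \<tturnstile> (\<chi> \<turnstile>[m] Eq s' t')"
  shows "T \<tturnstile> (\<chi> \<turnstile>[m] Eq (Plus s s') (Plus t t'))"
proof -
  let ?up = "subst_term (\<lambda>k. Var (Suc k))"
  have wf: "term_in_ctxt m s" "term_in_ctxt m s'" "term_in_ctxt m t" "fm_in_ctxt m \<chi>"
    using derives_wf[OF assms(1)] derives_wf[OF assms(2)] by auto
  have "T \<tturnstile> (\<chi> \<turnstile>[m] Eq (Plus s s') (Plus t s'))"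
    using derives_leibniz[OF assms(1), of "?up (Plus s s')" "Plus (Var 0) (?up s')"] wf
      derives_refl[of m "Plus s s'" "\<chi>" T]
    by (simp add: shift_term_ctxt)
  moreover have "T \<tturnstile> (\<chi> \<turnstile>[m] Eq (Plus t s') (Plus t t'))"
    using derives_leibniz[OF assms(2), of "?up (Plus t s')" "Plus (?up t) (Var 0)"] wf
      derives_refl[of m "Plus t s'" "\<chi>" T]
    by (simp add: shift_term_ctxt)
  ultimately show ?thesis by (rule derives_eq_trans)
qed

lemma derives_ex_intro:
  assumes "T \<tturnstile> (\<chi> \<turnstile>[m] subst_fm (case_nat t Var) \<phi>)" "fm_in_ctxt (Suc m) \<phi>" "term_in_ctxt m t"
  shows "T \<tturnstile> (\<chi> \<turnstile>[m] Ex \<phi>)"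
proof -
  have "T \<tturnstile> (\<phi> \<turnstile>[Suc m] weaken_fm (Ex \<phi>))"
    using assms by (intro ex_left_inv ident) auto
  then have "T \<tturnstile> (subst_fm (case_nat t Var) \<phi> \<turnstile>[m] subst_fm (case_nat t Var) (weaken_fm (Ex \<phi>)))"
    by (rule substitution) (use assms in \<open>auto split: nat.splits\<close>)
  also have "subst_fm (case_nat t Var) (weaken_fm (Ex \<phi>)) = Ex \<phi>"
    unfolding subst_weaken by (rule subst_fm_id[of m]) (use assms in auto)
  finally show ?thesis by (rule cut[OF assms(1)])
qed

section \<open>Arithmetic of MV-algebras\<close>

locale mv_alg =
  fixes A :: "'a mv_structure"
  assumes mv: "mv_algebra A"
begin

abbreviation carr where "carr \<equiv> mv_carrier A"
abbreviation plus (infixl "\<oplus>" 65) where "x \<oplus> y \<equiv> mv_plus A x y"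
abbreviation neg ("\<sim>_" [80] 80) where "\<sim>x \<equiv> mv_neg A x"
abbreviation zero ("\<zero>") where "\<zero> \<equiv> mv_zero A"
abbreviation one ("\<one>") where "\<one> \<equiv> \<sim>\<zero>"

lemma zero_closed [simp]: "\<zero> \<in> carr"
  and neg_closed [simp]: "x \<in> carr \<Longrightarrow> \<sim>x \<in> carr"
  and plus_closed [simp]: "x \<in> carr \<Longrightarrow> y \<in> carr \<Longrightarrow> x \<oplus> y \<in> carr"
  and plus_assoc: "x \<in> carr \<Longrightarrow> y \<in> carr \<Longrightarrow> z \<in> carr \<Longrightarrow> x \<oplus> y \<oplus> z = x \<oplus> (y \<oplus> z)"
  and plus_comm: "x \<in> carr \<Longrightarrow> y \<in> carr \<Longrightarrow> x \<oplus> y = y \<oplus> x"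
  and plus_zero [simp]: "x \<in> carr \<Longrightarrow> x \<oplus> \<zero> = x"
  and neg_neg [simp]: "x \<in> carr \<Longrightarrow> \<sim>\<sim>x = x"
  and plus_one [simp]: "x \<in> carr \<Longrightarrow> x \<oplus> \<one> = \<one>"
  and join_comm: "x \<in> carr \<Longrightarrow> y \<in> carr \<Longrightarrow> \<sim>(\<sim>x \<oplus> y) \<oplus> y = \<sim>(\<sim>y \<oplus> x) \<oplus> x"
  using mv unfolding mv_algebra_def by blast+

lemma plus_left_comm:
  "x \<in> carr \<Longrightarrow> y \<in> carr \<Longrightarrow> z \<in> carr \<Longrightarrow> x \<oplus> (y \<oplus> z) = y \<oplus> (x \<oplus> z)"
  by (metis plus_assoc plus_comm)

lemmas plus_ac = plus_assoc plus_comm plus_left_comm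

lemma zero_plus [simp]: "x \<in> carr \<Longrightarrow> \<zero> \<oplus> x = x"
  by (simp add: plus_comm[of \<zero>])

lemma one_plus [simp]: "x \<in> carr \<Longrightarrow> \<one> \<oplus> x = \<one>"
  by (simp add: plus_comm[of \<one>])

lemma plus_neg [simp]: "x \<in> carr \<Longrightarrow> x \<oplus> \<sim>x = \<one>"
  using join_comm[of x \<one>] by (simp add: plus_comm)

lemma neg_plus [simp]: "x \<in> carr \<Longrightarrow> \<sim>x \<oplus> x = \<one>"
  by (simp add: plus_comm[of "\<sim>x"])

lemma plus_neg_left [simp]: "x \<in> carr \<Longrightarrow> y \<in> carr \<Longrightarrow> x \<oplus> (\<sim>x \<oplus> y) = \<one>"
  by (simp flip: plus_assoc)

lemma neg_plus_left [simp]: "x \<in> carr \<Longrightarrow> y \<in> carr \<Longrightarrow> \<sim>x \<oplus> (x \<oplus> y) = \<one>"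
  by (simp flip: plus_assoc)

definition le (infix "\<sqsubseteq>" 50) where "x \<sqsubseteq> y \<longleftrightarrow> \<sim>x \<oplus> y = \<one>"

lemma le_trans:
  assumes "x \<sqsubseteq> y" "y \<sqsubseteq> z" "x \<in> carr" "y \<in> carr" "z \<in> carr"
  shows "x \<sqsubseteq> z"
proof -
  have "z = y \<oplus> \<sim>(\<sim>z \<oplus> y)"
    using join_comm[of y z] assms by (simp add: le_def plus_comm)
  then have "\<sim>x \<oplus> z = \<sim>x \<oplus> y \<oplus> \<sim>(\<sim>z \<oplus> y)"
    using assms plus_assoc by (metis neg_closed plus_closed)
  then show ?thesis
    using assms by (simp add: le_def)
qed

lemma le_antisym: "x \<sqsubseteq> y \<Longrightarrow> y \<sqsubseteq> x \<Longrightarrow> x \<in> carr \<Longrightarrow> y \<in> carr \<Longrightarrow> x = y"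
  using join_comm[of x y] by (simp add: le_def)

lemma le_plus_left: "x \<in> carr \<Longrightarrow> y \<in> carr \<Longrightarrow> x \<sqsubseteq> x \<oplus> y"
  by (simp add: le_def)

lemma le_zero: "x \<sqsubseteq> \<zero> \<Longrightarrow> x \<in> carr \<Longrightarrow> x = \<zero>"
  using neg_neg by (fastforce simp: le_def)

lemma le_plus_iff:
  "x \<in> carr \<Longrightarrow> y \<in> carr \<Longrightarrow> z \<in> carr \<Longrightarrow> x \<sqsubseteq> y \<oplus> z \<longleftrightarrow> \<sim>(\<sim>x \<oplus> z) \<sqsubseteq> y"
  by (simp add: le_def plus_ac)

lemma plus_mono:
  assumes "x \<sqsubseteq> y" "x \<in> carr" "y \<in> carr" "z \<in> carr"
  shows "x \<oplus> z \<sqsubseteq> y \<oplus> z"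
proof -
  let ?u = "\<sim>(\<sim>(x \<oplus> z) \<oplus> z)"
  have "?u \<sqsubseteq> x"
    using assms by (subst le_plus_iff[symmetric]) (simp_all add: le_def)
  then have "?u \<sqsubseteq> y"
    by (rule le_trans[OF _ assms(1)]) (use assms in auto)
  then show ?thesis
    using assms by (subst le_plus_iff) simp_all
qed

lemma plus_mono2:
  assumes "x \<sqsubseteq> y" "x' \<sqsubseteq> y'" "x \<in> carr" "y \<in> carr" "x' \<in> carr" "y' \<in> carr"
  shows "x \<oplus> x' \<sqsubseteq> y \<oplus> y'"
proof (rule le_trans)
  show "x \<oplus> x' \<sqsubseteq> y \<oplus> x'" using assms by (simp add: plus_mono)
  show "y \<oplus> x' \<sqsubseteq> y \<oplus> y'" using assms by (simp add: plus_mono plus_comm[of y])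
qed (use assms in auto)

definition idem where "idem c \<longleftrightarrow> c \<in> carr \<and> c \<oplus> c = c"

text \<open>
  Asking for both halves makes the notion visibly symmetric in \<open>d\<close> and \<open>\<sim>d\<close>, as the two pieces of a
  splitting are.
\<close>

definition boolean where "boolean d \<longleftrightarrow> idem d \<and> idem (\<sim>d)"

lemma idem_closed [simp]: "idem c \<Longrightarrow> c \<in> carr" by (auto simp: idem_def)
lemma idem_plus_self [simp]: "idem c \<Longrightarrow> c \<oplus> c = c" by (simp add: idem_def)
lemma idem_plus_self_left: "idem c \<Longrightarrow> x \<in> carr \<Longrightarrow> c \<oplus> (c \<oplus> x) = c \<oplus> x"
  by (simp flip: plus_assoc)
lemma idem_zero [simp]: "idem \<zero>" by (simp add: idem_def)
lemma idem_plus: "idem c \<Longrightarrow> idem d \<Longrightarrow> idem (c \<oplus> d)"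
  unfolding idem_def by (simp add: plus_ac) (simp flip: plus_assoc)

text \<open>
  Adding an idempotent is joining with it.  The inequality from right to left holds because
  the join \<open>?m\<close> of \<open>y\<close> and \<open>c\<close> absorbs \<open>c\<close>.
\<close>

lemma idem_join:
  assumes "idem c" "y \<in> carr"
  shows "\<sim>(\<sim>y \<oplus> c) \<oplus> c = y \<oplus> c"
proof (rule le_antisym)
  let ?m = "\<sim>(\<sim>y \<oplus> c) \<oplus> c"
  show "?m \<sqsubseteq> y \<oplus> c"
  proof (rule plus_mono)
    show "\<sim>(\<sim>y \<oplus> c) \<sqsubseteq> y" using assms by (simp add: le_def plus_ac)
  qed (use assms in auto)
  have "y \<sqsubseteq> ?m" using assms by (simp add: le_def plus_left_comm[of "\<sim>y" _ c])
  then have "y \<oplus> c \<sqsubseteq> ?m \<oplus> c" using assms by (simp add: plus_mono)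
  moreover have "?m \<oplus> c = ?m" using assms by (simp add: plus_assoc)
  ultimately show "y \<oplus> c \<sqsubseteq> ?m" by simp
qed (use assms in auto)

text \<open>
  For idempotent \<open>c\<close> this is the congruence generated by \<open>c = \<zero>\<close>.  The form \<open>x \<oplus> c = y \<oplus> c\<close> makes it an
  equivalence compatible with \<open>\<oplus>\<close> at once; negation needs \<open>idem_join\<close>.
\<close>

definition congr where "congr c x y \<longleftrightarrow> x \<oplus> c = y \<oplus> c"

lemma congr_refl [simp]: "congr c x x" by (simp add: congr_def)
lemma congr_sym: "congr c x y \<Longrightarrow> congr c y x" by (simp add: congr_def)
lemma congr_trans: "congr c x y \<Longrightarrow> congr c y z \<Longrightarrow> congr c x z" by (simp add: congr_def)

lemma congr_neg:
  assumes "idem c" "congr c x y" "x \<in> carr" "y \<in> carr"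
  shows "congr c (\<sim>x) (\<sim>y)"
proof -
  have "\<sim>x \<oplus> c = \<sim>(x \<oplus> c) \<oplus> c" "\<sim>y \<oplus> c = \<sim>(y \<oplus> c) \<oplus> c"
    using idem_join[of c "\<sim>x"] idem_join[of c "\<sim>y"] assms by auto
  then show ?thesis using assms(2) by (simp add: congr_def)
qed

lemma congr_plus:
  assumes "idem c" "congr c x y" "congr c x' y'" "x \<in> carr" "y \<in> carr" "x' \<in> carr" "y' \<in> carr"
  shows "congr c (x \<oplus> x') (y \<oplus> y')"
proof -
  have *: "z \<oplus> z' \<oplus> c = (z \<oplus> c) \<oplus> (z' \<oplus> c)" if "z \<in> carr" "z' \<in> carr" for z z'
    using that assms(1) by (simp add: plus_ac idem_plus_self_left)
  show ?thesis using assms by (simp add: congr_def *)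
qed

lemma congr_weaken: "congr c x y \<Longrightarrow> x \<in> carr \<Longrightarrow> y \<in> carr \<Longrightarrow> c \<in> carr \<Longrightarrow> d \<in> carr \<Longrightarrow>
  congr (c \<oplus> d) x y"
  by (simp add: congr_def flip: plus_assoc)

text \<open>
  The first summand is the truncated difference of \<open>p\<close> and \<open>d\<close>.  Any \<open>p\<close> is the sum of its truncated
  difference with \<open>d\<close> and its meet with \<open>d\<close>, and the meet with a Boolean element is a product.
\<close>

lemma boolean_decomp:
  assumes "boolean d" "p \<in> carr"
  shows "p = \<sim>(\<sim>p \<oplus> d) \<oplus> \<sim>(\<sim>p \<oplus> \<sim>d)"
proof -
  have d: "idem d" "idem (\<sim>d)" "d \<in> carr" using assms by (auto simp: boolean_def)
  have "\<sim>(\<sim>p \<oplus> d) \<oplus> \<sim>p = \<sim>p \<oplus> \<sim>d"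
    using join_comm[of "\<sim>d" "\<sim>p"] idem_join[of "\<sim>d" "\<sim>p"] d assms(2) by (simp add: plus_comm)
  then have "\<sim>(\<sim>p \<oplus> d) \<oplus> \<sim>(\<sim>p \<oplus> \<sim>d) = \<sim>(\<sim>p \<oplus> \<sim>(\<sim>p \<oplus> d)) \<oplus> \<sim>(\<sim>p \<oplus> d)"
    using d assms(2) by (simp add: plus_comm)
  also have "\<dots> = p"
    using join_comm[of p "\<sim>(\<sim>p \<oplus> d)"] d assms(2) by (simp add: plus_ac)
  finally show ?thesis by simp
qed

text \<open>
  For Boolean \<open>d\<close> the algebra embeds into the product of its quotients by \<open>d\<close> and \<open>\<sim>d\<close>, because
  \<open>boolean_decomp\<close> writes \<open>p\<close> as the sum of \<open>\<sim>(\<sim>p \<oplus> d)\<close> and \<open>\<sim>(\<sim>p \<oplus> \<sim>d)\<close>, and these are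
  determined by \<open>p\<close> modulo \<open>d\<close> and modulo \<open>\<sim>d\<close>.
\<close>

lemma congr_separate:
  assumes "boolean d" "congr d p q" "congr (\<sim>d) p q" "p \<in> carr" "q \<in> carr"
  shows "p = q"
proof -
  have d: "idem d" "idem (\<sim>d)" using assms by (auto simp: boolean_def)
  have "\<sim>p \<oplus> d = \<sim>q \<oplus> d" "\<sim>p \<oplus> \<sim>d = \<sim>q \<oplus> \<sim>d"
    using congr_neg[OF d(1) assms(2,4,5)] congr_neg[OF d(2) assms(3-5)] by (simp_all add: congr_def)
  then show ?thesis
    by (metis assms(1,4,5) boolean_decomp)
qed

lemma congr_glue:
  assumes "boolean d" "c \<in> carr" "congr (c \<oplus> d) p q" "congr (c \<oplus> \<sim>d) p q" "p \<in> carr" "q \<in> carr"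
  shows "congr c p q"
proof -
  have d: "d \<in> carr" using assms by (auto simp: boolean_def)
  have "p \<oplus> c = q \<oplus> c"
    using assms d by (intro congr_separate[OF assms(1)]) (auto simp: congr_def plus_assoc)
  then show ?thesis by (simp add: congr_def)
qed

lemma boolean_neg: "boolean d \<Longrightarrow> boolean (\<sim>d)"
  by (auto simp: boolean_def)

text \<open>
  The embedding into the product of the two quotients is onto: the element equal to \<open>x\<close> modulo \<open>d\<close>
  and to \<open>y\<close> modulo \<open>\<sim>d\<close> is the sum of the part of \<open>x\<close> below \<open>\<sim>d\<close> and the part of \<open>y\<close> below \<open>d\<close>.
\<close>

lemma element_glue:
  assumes "boolean d" "x \<in> carr" "y \<in> carr"
  obtains z where "z \<in> carr" "congr d z x" "congr (\<sim>d) z y"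
proof -
  have *: "congr d (\<sim>(\<sim>x \<oplus> d) \<oplus> \<sim>(\<sim>y \<oplus> \<sim>d)) x"
    if b: "boolean d" and xy: "x \<in> carr" "y \<in> carr" for d x y
  proof -
    have d: "idem d" "d \<in> carr" using b by (auto simp: boolean_def)
    have "congr d (\<sim>x \<oplus> d) (\<sim>x)" using d xy by (simp add: congr_def plus_assoc)
    then have 1: "congr d (\<sim>(\<sim>x \<oplus> d)) x" using congr_neg[OF d(1)] d xy by fastforce
    have "congr d (\<sim>y \<oplus> \<sim>d) \<one>" using d xy by (simp add: congr_def plus_assoc)
    then have 2: "congr d (\<sim>(\<sim>y \<oplus> \<sim>d)) \<zero>" using congr_neg[OF d(1)] d xy by fastforce
    show ?thesis using congr_plus[OF d(1) 1 2] d xy by simp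
  qed
  have d: "d \<in> carr" using assms by (auto simp: boolean_def)
  show thesis
  proof (rule that)
    show "congr d (\<sim>(\<sim>x \<oplus> d) \<oplus> \<sim>(\<sim>y \<oplus> \<sim>d)) x" using * assms by blast
    show "congr (\<sim>d) (\<sim>(\<sim>x \<oplus> d) \<oplus> \<sim>(\<sim>y \<oplus> \<sim>d)) y"
      using *[OF boolean_neg[OF assms(1)] assms(3,2)] assms d by (simp add: plus_comm)
  qed (use assms d in simp)
qed

text \<open>
  This says \<open>u \<and> v = 0\<close>; quantifying over common lower bounds avoids computing with the
  term for the meet.
\<close>

definition orthogonal where "orthogonal u v \<longleftrightarrow> (\<forall>z\<in>carr. z \<sqsubseteq> u \<longrightarrow> z \<sqsubseteq> v \<longrightarrow> z = \<zero>)"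

lemma orthogonal_sym: "orthogonal u v \<Longrightarrow> orthogonal v u" by (auto simp: orthogonal_def)

lemma orthogonal_le: "orthogonal u v \<Longrightarrow> u' \<sqsubseteq> u \<Longrightarrow> u \<in> carr \<Longrightarrow> u' \<in> carr \<Longrightarrow> orthogonal u' v"
  unfolding orthogonal_def using le_trans by blast

text \<open>
  If \<open>z\<close> is below \<open>u \<oplus> u'\<close> and \<open>v\<close>, then by residuation the truncated difference of \<open>z\<close> and \<open>u'\<close>
  is below both \<open>u\<close> and \<open>v\<close>, so it is zero and \<open>z\<close> is below \<open>u'\<close>.
\<close>

lemma orthogonal_plus:
  assumes "orthogonal u v" "orthogonal u' v" "u \<in> carr" "u' \<in> carr" "v \<in> carr"
  shows "orthogonal (u \<oplus> u') v"
  unfolding orthogonal_def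
proof (intro ballI impI)
  fix z assume z: "z \<in> carr" "z \<sqsubseteq> u \<oplus> u'" "z \<sqsubseteq> v"
  have "\<sim>(\<sim>z \<oplus> u') \<sqsubseteq> z" using z assms by (simp add: le_def plus_ac)
  then have "\<sim>(\<sim>z \<oplus> u') \<sqsubseteq> v" by (rule le_trans[OF _ z(3)]) (use z assms in auto)
  moreover have "\<sim>(\<sim>z \<oplus> u') \<sqsubseteq> u" using z assms le_plus_iff[of z u u'] by simp
  ultimately have "\<sim>(\<sim>z \<oplus> u') = \<zero>" using assms z by (simp add: orthogonal_def)
  then have "z \<sqsubseteq> u'" using assms z by (metis le_def neg_neg neg_closed plus_closed)
  then show "z = \<zero>" using assms(2) z by (simp add: orthogonal_def)
qed

primrec mult where
  "mult 0 x = \<zero>"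
| "mult (Suc k) x = x \<oplus> mult k x"

lemma mult_closed [simp]: "x \<in> carr \<Longrightarrow> mult k x \<in> carr"
  by (induction k) auto

lemma mult_plus: "x \<in> carr \<Longrightarrow> y \<in> carr \<Longrightarrow> mult k (x \<oplus> y) = mult k x \<oplus> mult k y"
  by (induction k) (auto simp: plus_ac)

lemma orthogonal_mult: "orthogonal u v \<Longrightarrow> u \<in> carr \<Longrightarrow> v \<in> carr \<Longrightarrow> orthogonal (mult k u) v"
  by (induction k) (auto simp: orthogonal_plus, auto simp: orthogonal_def le_zero)

lemma orthogonal_mult2: "orthogonal u v \<Longrightarrow> u \<in> carr \<Longrightarrow> v \<in> carr \<Longrightarrow> orthogonal (mult k u) (mult k v)"
  by (meson orthogonal_mult orthogonal_sym mult_closed)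

text \<open>
  The element \<open>?z\<close> in the proof is the meet of \<open>x\<close> and \<open>\<sim>x\<close>, in the form \<open>x \<odot> (\<sim>x \<oplus> \<sim>x)\<close>; that
  it vanishes means \<open>\<sim>x \<oplus> \<sim>x \<sqsubseteq> \<sim>x\<close>.
\<close>

lemma orthogonal_neg_boolean:
  assumes "orthogonal x (\<sim>x)" "x \<in> carr"
  shows "boolean x"
proof -
  have *: "idem (\<sim>x)" if "orthogonal x (\<sim>x)" "x \<in> carr" for x
  proof -
    let ?z = "\<sim>(\<sim>x \<oplus> \<sim>(\<sim>x \<oplus> \<sim>x))"
    have "?z \<sqsubseteq> x" "?z \<sqsubseteq> \<sim>x"
      using that by (simp_all add: le_def plus_ac) (simp flip: plus_assoc)
    then have "?z = \<zero>" using that by (simp add: orthogonal_def)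
    then have "\<sim>x \<oplus> \<sim>(\<sim>x \<oplus> \<sim>x) = \<one>" using that by (metis neg_neg neg_closed plus_closed)
    then have "\<sim>x \<oplus> \<sim>x \<sqsubseteq> \<sim>x" using that by (simp add: le_def plus_comm)
    then have "\<sim>x \<oplus> \<sim>x = \<sim>x" by (rule le_antisym) (use that in \<open>auto simp: le_plus_left\<close>)
    then show ?thesis using that unfolding idem_def by simp
  qed
  have "orthogonal (\<sim>x) (\<sim>\<sim>x)" using assms orthogonal_sym by simp
  then show ?thesis using *[of x] *[of "\<sim>x"] assms by (simp add: boolean_def)
qed

lemma le_neg: "x \<sqsubseteq> y \<Longrightarrow> x \<in> carr \<Longrightarrow> y \<in> carr \<Longrightarrow> \<sim>y \<sqsubseteq> \<sim>x"
  by (simp add: le_def plus_comm)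

text \<open>
  \<open>\<sim>(\<sim>x \<oplus> y) \<oplus> y\<close> is the join of \<open>x\<close> and \<open>y\<close>, and the last MV-axiom is its commutativity.
\<close>

lemma join_least:
  assumes "x \<sqsubseteq> w" "y \<sqsubseteq> w" "x \<in> carr" "y \<in> carr" "w \<in> carr"
  shows "\<sim>(\<sim>x \<oplus> y) \<oplus> y \<sqsubseteq> w"
proof -
  have "\<sim>(\<sim>x \<oplus> y) \<sqsubseteq> \<sim>(\<sim>w \<oplus> y)"
    by (intro le_neg plus_mono) (use assms in auto)
  then have "\<sim>(\<sim>x \<oplus> y) \<oplus> y \<sqsubseteq> \<sim>(\<sim>w \<oplus> y) \<oplus> y"
    by (rule plus_mono) (use assms in auto)
  also have "\<sim>(\<sim>w \<oplus> y) \<oplus> y = w"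
    using join_comm[of w y] assms by (simp add: le_def)
  finally show ?thesis .
qed

text \<open>
  Prelinearity: \<open>\<sim>p \<oplus> q\<close> and \<open>\<sim>q \<oplus> p\<close> have join \<open>\<one>\<close>.  In a chain one of them is \<open>\<one>\<close>.  In general the
  join is rewritten by commutativity of joins until the complementary summands \<open>q\<close> and \<open>\<sim>q\<close>
  appear side by side.
\<close>

lemma prelinear_join:
  assumes p: "p \<in> carr" and q: "q \<in> carr"
  shows "\<sim>(\<sim>(\<sim>p \<oplus> q) \<oplus> (\<sim>q \<oplus> p)) \<oplus> (\<sim>q \<oplus> p) = \<one>"
proof -
  define t where "t = \<sim>(\<sim>p \<oplus> q)"
  define r where "r = t \<oplus> \<sim>q"
  have c: "t \<in> carr" "r \<in> carr" using p q by (simp_all add: t_def r_def)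
  have "\<sim>(t \<oplus> (\<sim>q \<oplus> p)) \<oplus> (\<sim>q \<oplus> p) = \<sim>q \<oplus> (\<sim>(r \<oplus> p) \<oplus> p)"
    using p q c by (simp add: r_def plus_assoc plus_left_comm[of _ "\<sim>q" p])
  also have "\<sim>(r \<oplus> p) \<oplus> p = \<sim>(\<sim>p \<oplus> \<sim>r) \<oplus> \<sim>r"
    using join_comm[of "\<sim>r" p] p c by simp
  also have "\<sim>q \<oplus> (\<sim>(\<sim>p \<oplus> \<sim>r) \<oplus> \<sim>r) = \<sim>(\<sim>p \<oplus> \<sim>r) \<oplus> (\<sim>(t \<oplus> \<sim>q) \<oplus> \<sim>q)"
    unfolding r_def using p q c by (simp add: plus_ac)
  also have "\<sim>(t \<oplus> \<sim>q) \<oplus> \<sim>q = \<sim>(q \<oplus> \<sim>t) \<oplus> (\<sim>p \<oplus> q)"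
    using join_comm[of "\<sim>t" "\<sim>q"] p q c by (simp add: t_def)
  also have "\<sim>(\<sim>p \<oplus> \<sim>r) \<oplus> (\<sim>(q \<oplus> \<sim>t) \<oplus> (\<sim>p \<oplus> q)) =
      (\<sim>(\<sim>r \<oplus> \<sim>p) \<oplus> \<sim>p) \<oplus> (\<sim>(q \<oplus> \<sim>t) \<oplus> q)"
    using p q c by (simp add: plus_ac)
  also have "\<sim>(\<sim>r \<oplus> \<sim>p) \<oplus> \<sim>p = \<sim>(p \<oplus> r) \<oplus> r"
    using join_comm[of r "\<sim>p"] p c by simp
  also have "\<sim>(p \<oplus> r) \<oplus> r \<oplus> (\<sim>(q \<oplus> \<sim>t) \<oplus> q) = (q \<oplus> \<sim>q) \<oplus> (t \<oplus> (\<sim>(p \<oplus> r) \<oplus> \<sim>(q \<oplus> \<sim>t)))"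
    unfolding r_def using p q c by (simp only: plus_ac plus_closed neg_closed)
  also have "\<dots> = \<one>"
    using p q c by simp
  finally show ?thesis by (simp add: t_def)
qed

lemma prelinear:
  assumes "p \<in> carr" "q \<in> carr"
  shows "orthogonal (\<sim>(\<sim>p \<oplus> q)) (\<sim>(\<sim>q \<oplus> p))"
  unfolding orthogonal_def
proof (intro ballI impI)
  fix z assume z: "z \<in> carr" "z \<sqsubseteq> \<sim>(\<sim>p \<oplus> q)" "z \<sqsubseteq> \<sim>(\<sim>q \<oplus> p)"
  have "\<sim>p \<oplus> q \<sqsubseteq> \<sim>z" "\<sim>q \<oplus> p \<sqsubseteq> \<sim>z"
    using le_neg[OF z(2)] le_neg[OF z(3)] z assms by auto
  then have "\<sim>(\<sim>(\<sim>p \<oplus> q) \<oplus> (\<sim>q \<oplus> p)) \<oplus> (\<sim>q \<oplus> p) \<sqsubseteq> \<sim>z"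
    by (rule join_least) (use z assms in auto)
  then have "\<sim>\<one> \<oplus> \<sim>z = \<one>"
    using prelinear_join[OF assms] by (simp add: le_def)
  then show "z = \<zero>" using z by (metis neg_neg neg_closed zero_closed zero_plus)
qed

lemma mult_two: "x \<in> carr \<Longrightarrow> mult 2 x = x \<oplus> x"
  by (simp add: numeral_2_eq_2)

text \<open>
  Let \<open>m = n + 1\<close> and \<open>q = \<not>(nx)\<close>.  The join \<open>w\<close> of \<open>x\<close> and \<open>q\<close> has \<open>mw = 1\<close>, since \<open>w\<close> is above \<open>q\<close>
  and \<open>nw\<close> above \<open>nx\<close>.  Let \<open>u\<close> and \<open>v\<close> be the truncated differences of \<open>x\<close> and \<open>q\<close> and of \<open>q\<close> and
  \<open>x\<close>, so that \<open>w = u \<oplus> q = v \<oplus> x\<close>.  Then \<open>\<not>(mq)\<close> lies below \<open>mu\<close> and \<open>\<not>(mx)\<close> below \<open>mv\<close>.  Since \<open>u\<close>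
  and \<open>v\<close> are orthogonal, so are the doubles of \<open>\<not>(mx)\<close> and \<open>\<not>(mq)\<close>, and the equation \<open>ax\<close> says that
  these two are complements of each other.
\<close>

lemma boolean_of_axiom:
  assumes x: "x \<in> carr" and m: "m = Suc n"
    and ax: "mult 2 (\<sim>(mult m x)) = \<sim>(mult 2 (\<sim>(mult m (\<sim>(mult n x)))))"
  shows "boolean (mult 2 (\<sim>(mult m x)))"
proof -
  define q where "q = \<sim>(mult n x)"
  define u where "u = \<sim>(\<sim>x \<oplus> q)"
  define v where "v = \<sim>(\<sim>q \<oplus> x)"
  have c: "q \<in> carr" "u \<in> carr" "v \<in> carr" using x by (simp_all add: q_def u_def v_def)
  have w: "u \<oplus> q = v \<oplus> x"
    unfolding u_def v_def using c x by (simp add: join_comm)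
  have "mult m (u \<oplus> q) = (u \<oplus> q) \<oplus> mult n (v \<oplus> x)"
    using w by (simp add: m)
  also have "\<dots> = (q \<oplus> mult n x) \<oplus> (u \<oplus> mult n v)"
    using c x by (simp add: mult_plus plus_ac)
  also have "\<dots> = \<one>"
    using c x by (simp add: q_def)
  finally have one: "mult m (u \<oplus> q) = \<one>" .
  have "\<sim>(mult m q) \<sqsubseteq> mult m u"
    using one c by (simp add: le_def mult_plus plus_comm)
  moreover have "\<sim>(mult m x) \<sqsubseteq> mult m v"
    using one[unfolded w] c x by (simp add: le_def mult_plus plus_comm)
  ultimately have le: "mult 2 (\<sim>(mult m q)) \<sqsubseteq> mult 2 (mult m u)"
      "mult 2 (\<sim>(mult m x)) \<sqsubseteq> mult 2 (mult m v)"
    using c x by (simp_all add: mult_two plus_mono2)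
  have "orthogonal u v" unfolding u_def v_def using x c by (intro prelinear)
  then have "orthogonal (mult 2 (mult m v)) (mult 2 (mult m u))"
    using orthogonal_mult2[of v u] orthogonal_mult2[of "mult m v" "mult m u"] orthogonal_sym[of u v] c by simp
  then have "orthogonal (mult 2 (\<sim>(mult m x))) (mult 2 (mult m u))"
    by (rule orthogonal_le) (use le c x in auto)
  then have "orthogonal (mult 2 (\<sim>(mult m x))) (mult 2 (\<sim>(mult m q)))"
    using orthogonal_le[OF orthogonal_sym le(1)] orthogonal_sym c x by simp
  moreover have "mult 2 (\<sim>(mult m q)) = \<sim>(mult 2 (\<sim>(mult m x)))"
    unfolding ax q_def using x by simp
  ultimately show ?thesis
    using x by (intro orthogonal_neg_boolean) auto
qed

section \<open>Boolean-local forcing\<close>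

text \<open>
  The worlds of the forcing relation are idempotents: \<open>c\<close> stands for the quotient by \<open>c\<close>, so larger
  elements are smaller worlds, \<open>\<zero>\<close> is the whole algebra and \<open>\<one>\<close> its trivial quotient.  A
  Boolean \<open>d\<close> covers \<open>c\<close> by \<open>c \<oplus> d\<close> and \<open>c \<oplus> \<sim>d\<close>, and \<open>cover P c\<close> says that \<open>P\<close> holds on all pieces
  of \<open>c\<close> after finitely many such splittings.
\<close>

inductive cover :: "('a \<Rightarrow> bool) \<Rightarrow> 'a \<Rightarrow> bool" for P where
  here: "P c \<Longrightarrow> cover P c"
| split: "boolean d \<Longrightarrow> cover P (c \<oplus> d) \<Longrightarrow> cover P (c \<oplus> \<sim>d) \<Longrightarrow> cover P c"

text \<open>
  Falsity is forced at the trivial quotient, where every formula must be forced for \<open>\<bottom>\<close> to entail it.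
  The quantifier needs no \<open>cover\<close>, as witnesses found on the pieces of a splitting glue.
\<close>

primrec forces :: "'i geom_fm \<Rightarrow> (nat \<Rightarrow> 'a) \<Rightarrow> 'a \<Rightarrow> bool" where
  "forces (Eq s t) v c \<longleftrightarrow> congr c (mv_eval A v s) (mv_eval A v t)"
| "forces Top v c \<longleftrightarrow> True"
| "forces (And \<phi> \<psi>) v c \<longleftrightarrow> forces \<phi> v c \<and> forces \<psi> v c"
| "forces Bot v c \<longleftrightarrow> c = \<one>"
| "forces (Or \<phi> \<psi>) v c \<longleftrightarrow> cover (\<lambda>c. forces \<phi> v c \<or> forces \<psi> v c) c"
| "forces (Disj f) v c \<longleftrightarrow> cover (\<lambda>c. \<exists>i. forces (f i) v c) c"
| "forces (Ex \<phi>) v c \<longleftrightarrow> (\<exists>a\<in>carr. forces \<phi> (case_nat a v) c)"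

definition valuation :: "(nat \<Rightarrow> 'a) \<Rightarrow> bool" where
  "valuation v \<longleftrightarrow> (\<forall>i. v i \<in> carr)"

lemma valuation_case_nat [simp]: "valuation (case_nat a v) \<longleftrightarrow> a \<in> carr \<and> valuation v"
  by (force simp: valuation_def split: nat.splits)

lemma eval_closed [simp]: "valuation v \<Longrightarrow> mv_eval A v t \<in> carr"
  by (induction t) (auto simp: valuation_def)

lemma valuation_eval [simp]: "valuation v \<Longrightarrow> valuation (\<lambda>i. mv_eval A v (\<sigma> i))"
  using eval_closed unfolding valuation_def[of "\<lambda>i. mv_eval A v (\<sigma> i)"] by blast

lemma eval_congr:
  assumes "idem c" "valuation v" "valuation v'" "\<And>i. congr c (v i) (v' i)"
  shows "congr c (mv_eval A v t) (mv_eval A v' t)"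
  using assms by (induction t) (auto intro: congr_neg congr_plus)

lemma idem_plus_boolean: "idem c \<Longrightarrow> boolean d \<Longrightarrow> idem (c \<oplus> d)"
  by (simp add: boolean_def idem_plus)

lemma boolean_closed: "boolean d \<Longrightarrow> d \<in> carr"
  by (simp add: boolean_def)

lemma cover_map:
  assumes "cover P c" "R c" "\<And>c d. R c \<Longrightarrow> boolean d \<Longrightarrow> R (c \<oplus> d)" "\<And>c. R c \<Longrightarrow> P c \<Longrightarrow> Q c"
  shows "cover Q c"
  using assms(1,2) by induction (auto intro: assms(3,4) cover.intros boolean_neg)

text \<open>
  Splitting a world along \<open>d\<close> commutes with restricting it by \<open>e\<close>, so the covers are stable.
\<close>

lemma cover_shift:
  assumes "cover P c" "idem c" "e \<in> carr" "\<And>c. idem c \<Longrightarrow> P c \<Longrightarrow> Q (c \<oplus> e)"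
  shows "cover Q (c \<oplus> e)"
  using assms(1,2)
proof induction
  case (here c)
  then show ?case by (auto intro: assms(4) cover.here)
next
  case (split d c)
  have d: "d \<in> carr" "idem (c \<oplus> d)" "idem (c \<oplus> \<sim>d)" "c \<in> carr"
    using split by (auto intro: idem_plus_boolean boolean_neg boolean_closed)
  show ?case
  proof (rule cover.split[OF split(1)])
    show "cover Q (c \<oplus> e \<oplus> d)" "cover Q (c \<oplus> e \<oplus> \<sim>d)"
      using split.IH d assms(3) by (simp_all add: plus_ac)
  qed
qed

lemma forces_subst: "forces (subst_fm \<sigma> \<phi>) v c \<longleftrightarrow> forces \<phi> (\<lambda>i. mv_eval A v (\<sigma> i)) c"
proof (induction \<phi> arbitrary: \<sigma> v c)
  case (Eq s t)
  have "mv_eval A v (subst_term \<sigma> t) = mv_eval A (\<lambda>i. mv_eval A v (\<sigma> i)) t" for t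
    by (induction t) auto
  then show ?case by simp
next
  case (Ex \<phi>)
  have "mv_eval A (case_nat a v) (subst_term (\<lambda>k. Var (Suc k)) t) = mv_eval A v t" for a t
    by (induction t) auto
  then have "(\<lambda>i. mv_eval A (case_nat a v) (lift_subst \<sigma> i)) = case_nat a (\<lambda>i. mv_eval A v (\<sigma> i))" for a
    by (auto simp: lift_subst_def fun_eq_iff split: nat.splits)
  then show ?case using Ex by simp
qed auto

lemma forces_weaken: "forces (weaken_fm \<phi>) (case_nat a v) c \<longleftrightarrow> forces \<phi> v c"
  by (simp add: weaken_fm_def forces_subst)

lemma forces_congr:
  assumes "forces \<phi> v c" "idem c" "valuation v" "valuation v'" "\<And>i. congr c (v i) (v' i)"
  shows "forces \<phi> v' c"
  using assms
proof (induction \<phi> arbitrary: v v' c)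
  case (Eq s t)
  then show ?case
    using eval_congr[of c v v'] by (metis congr_sym congr_trans forces.simps(1))
next
  case (Or \<phi> \<psi>)
  from Or.prems(1) have "cover (\<lambda>c. forces \<phi> v c \<or> forces \<psi> v c) c" by simp
  then have "cover (\<lambda>c. forces \<phi> v' c \<or> forces \<psi> v' c) c"
    by (rule cover_map[where R = "\<lambda>c. idem c \<and> (\<forall>i. congr c (v i) (v' i))"])
      (use Or in \<open>auto intro: idem_plus_boolean congr_weaken boolean_closed simp: valuation_def\<close>)
  then show ?case by simp
next
  case (Disj f)
  from Disj.prems(1) have "cover (\<lambda>c. \<exists>i. forces (f i) v c) c" by simp
  then have "cover (\<lambda>c. \<exists>i. forces (f i) v' c) c"
  proof (rule cover_map[where R = "\<lambda>c. idem c \<and> (\<forall>i. congr c (v i) (v' i))"])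
    show "\<exists>i. forces (f i) v' c"
      if "idem c \<and> (\<forall>i. congr c (v i) (v' i))" "\<exists>i. forces (f i) v c" for c
      using that Disj.IH[OF rangeI] Disj.prems(3,4) by blast
  qed (use Disj.prems in \<open>auto intro: idem_plus_boolean congr_weaken boolean_closed simp: valuation_def\<close>)
  then show ?case by simp
next
  case (Ex \<phi>)
  then obtain a where a: "a \<in> carr" "forces \<phi> (case_nat a v) c" by auto
  have "forces \<phi> (case_nat a v') c"
    by (rule Ex.IH[OF a(2)]) (use Ex.prems a in \<open>auto split: nat.splits\<close>)
  then show ?case using a by auto
qed auto

lemma forces_mono:
  assumes "forces \<phi> v c" "idem c" "valuation v" "idem e"
  shows "forces \<phi> v (c \<oplus> e)"
  using assms
proof (induction \<phi> arbitrary: v c)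
  case (Eq s t)
  then show ?case by (simp add: congr_weaken)
next
  case (Or \<phi> \<psi>)
  then have "cover (\<lambda>c. forces \<phi> v c \<or> forces \<psi> v c) c" by simp
  then have "cover (\<lambda>c. forces \<phi> v c \<or> forces \<psi> v c) (c \<oplus> e)"
    by (rule cover_shift) (use Or in auto)
  then show ?case by simp
next
  case (Disj f)
  then have "cover (\<lambda>c. \<exists>i. forces (f i) v c) c" by simp
  then have "cover (\<lambda>c. \<exists>i. forces (f i) v c) (c \<oplus> e)"
  proof (rule cover_shift)
    show "\<exists>i. forces (f i) v (c \<oplus> e)" if "idem c" "\<exists>i. forces (f i) v c" for c
      using that Disj.IH[OF rangeI] Disj.prems(3,4) by blast
  qed (use Disj.prems in auto)
  then show ?case by simp
next
  case (Ex \<phi>)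
  then obtain a where "a \<in> carr" "forces \<phi> (case_nat a v) c" by auto
  with Ex.prems have "forces \<phi> (case_nat a v) (c \<oplus> e)" using Ex.IH by simp
  then show ?case using \<open>a \<in> carr\<close> by auto
qed auto

text \<open>
  Forcing is a local property.  For equations this is \<open>congr_separate\<close>.  For \<open>Ex\<close> the witnesses on
  the two pieces are glued to a single one, which serves on each piece because forcing respects
  the congruence of the world.
\<close>

lemma forces_glue:
  assumes "boolean d" "idem c" "valuation v" "forces \<phi> v (c \<oplus> d)" "forces \<phi> v (c \<oplus> \<sim>d)"
  shows "forces \<phi> v c"
  using assms
proof (induction \<phi> arbitrary: v c)
  case (Eq s t)
  then show ?case by (simp add: congr_glue)
next
  case Bot
  then have "c = \<one>"
    by (intro congr_separate[OF Bot(1)]) (auto simp: congr_def boolean_closed)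
  then show ?case by simp
next
  case (Or \<phi> \<psi>)
  then show ?case by (auto intro: cover.split)
next
  case (Disj f)
  then show ?case by (auto intro: cover.split)
next
  case (Ex \<phi>)
  then obtain a b where ab: "a \<in> carr" "forces \<phi> (case_nat a v) (c \<oplus> d)"
    "b \<in> carr" "forces \<phi> (case_nat b v) (c \<oplus> \<sim>d)" by auto
  obtain z where z: "z \<in> carr" "congr d z a" "congr (\<sim>d) z b"
    using element_glue[OF Ex.prems(1) ab(1,3)] .
  have d: "d \<in> carr" "c \<in> carr" "idem (c \<oplus> d)" "idem (c \<oplus> \<sim>d)"
    using Ex.prems by (auto intro: idem_plus_boolean boolean_neg boolean_closed)
  have cong: "congr (c \<oplus> d) z a" "congr (c \<oplus> \<sim>d) z b"
    using congr_weaken[OF z(2) _ _ _ d(2)] congr_weaken[OF z(3) _ _ _ d(2)] z ab d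
    by (simp_all add: plus_comm[of c])
  have "forces \<phi> (case_nat z v) (c \<oplus> d)"
    by (rule forces_congr[OF ab(2)])
      (use Ex.prems ab z d cong in \<open>auto intro: congr_sym split: nat.splits\<close>)
  moreover have "forces \<phi> (case_nat z v) (c \<oplus> \<sim>d)"
    by (rule forces_congr[OF ab(4)])
      (use Ex.prems ab z d cong in \<open>auto intro: congr_sym split: nat.splits\<close>)
  ultimately have "forces \<phi> (case_nat z v) c"
    using Ex.IH Ex.prems z by simp
  then show ?case using z by auto
qed auto

lemma forces_local:
  assumes "cover (forces \<phi> v) c" "idem c" "valuation v"
  shows "forces \<phi> v c"
  using assms(1,2)
  by induction (auto intro: forces_glue[OF _ _ assms(3)] idem_plus_boolean boolean_neg)

lemma forces_one:
  assumes "valuation v"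
  shows "forces \<phi> v \<one>"
  using assms by (induction \<phi> arbitrary: v) (auto simp: congr_def intro: cover.here zero_closed)

primrec valid :: "'i sequent \<Rightarrow> bool" where
  "valid (\<phi> \<turnstile>[n] \<psi>) \<longleftrightarrow>
    (\<forall>c v. idem c \<longrightarrow> valuation v \<longrightarrow> forces \<phi> v c \<longrightarrow> forces \<psi> v c)"

lemma cover_idem_map:
  assumes "cover P c" "idem c" "\<And>c. idem c \<Longrightarrow> P c \<Longrightarrow> Q c"
  shows "cover Q c"
  by (rule cover_map[OF assms(1), of idem]) (auto intro: assms idem_plus_boolean)

text \<open>
  Locality gives the left rules for disjunctions, and monotonicity the two distributive laws; the
  equality rule is invariance of forcing under the congruence of the world.
\<close>

theorem derives_valid:
  assumes "\<And>s. s \<in> T \<Longrightarrow> valid s" and "T \<tturnstile> s"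
  shows "valid s"
  using assms(2)
proof induction
  case (ax s)
  then show ?case by (simp add: assms(1))
next
  case (substitution \<phi> n \<psi> m \<sigma>)
  then show ?case by (simp add: forces_subst)
next
  case (eq_subst i n j \<phi>)
  show ?case
    unfolding valid.simps
  proof (intro allI impI)
    fix c v
    assume c: "idem c" "valuation v" "forces (And (Eq (Var i) (Var j)) \<phi>) v c"
    have "(\<lambda>k. mv_eval A v ((Var(i := Var j)) k)) = v(i := v j)" by auto
    moreover have "forces \<phi> (v(i := v j)) c"
      by (rule forces_congr[of _ v]) (use c in \<open>auto simp: valuation_def\<close>)
    ultimately show "forces (subst_fm (Var(i := Var j)) \<phi>) v c"
      by (simp add: forces_subst)
  qed
next
  case (or_left \<phi> n \<chi> \<psi>)
  show ?case
    unfolding valid.simps forces.simps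
  proof (intro allI impI)
    fix c v
    assume c: "idem c" "valuation v" "cover (\<lambda>c. forces \<phi> v c \<or> forces \<psi> v c) c"
    show "forces \<chi> v c"
      by (rule forces_local[OF cover_idem_map[OF c(3,1)]]) (use or_left c in auto)
  qed
next
  case (disj_left f n \<chi>)
  show ?case
    unfolding valid.simps forces.simps
  proof (intro allI impI)
    fix c v
    assume c: "idem c" "valuation v" "cover (\<lambda>c. \<exists>i. forces (f i) v c) c"
    show "forces \<chi> v c"
      by (rule forces_local[OF cover_idem_map[OF c(3,1)]]) (use disj_left c in auto)
  qed
next
  case (ex_left \<phi> n \<psi>)
  then show ?case by simp (metis forces_weaken valuation_case_nat)
next
  case (ex_left_inv \<phi> n \<psi>)
  have "forces (weaken_fm \<psi>) v c" if "idem c" "valuation v" "forces \<phi> v c" for c v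
  proof -
    have v: "v = case_nat (v 0) (\<lambda>i. v (Suc i))" by (auto split: nat.splits)
    then have "forces (Ex \<phi>) (\<lambda>i. v (Suc i)) c"
      using that by (auto simp: valuation_def intro!: bexI[of _ "v 0"])
    then have "forces \<psi> (\<lambda>i. v (Suc i)) c"
      using ex_left_inv that by (simp add: valuation_def)
    then show ?thesis by (metis v forces_weaken)
  qed
  then show ?case by simp
next
  case (distrib_or n \<phi> \<psi> \<chi>)
  have "cover (\<lambda>c. forces \<phi> v c \<and> forces \<psi> v c \<or> forces \<phi> v c \<and> forces \<chi> v c) c"
    if "idem c" "valuation v" "forces \<phi> v c" "cover (\<lambda>c. forces \<psi> v c \<or> forces \<chi> v c) c" for c v
    by (rule cover_map[OF that(4), where R = "\<lambda>c. idem c \<and> forces \<phi> v c"])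
      (use that in \<open>auto intro: idem_plus_boolean forces_mono simp: boolean_def\<close>)
  then show ?case by simp
next
  case (distrib_disj n \<phi> f)
  have "cover (\<lambda>c. \<exists>i. forces \<phi> v c \<and> forces (f i) v c) c"
    if "idem c" "valuation v" "forces \<phi> v c" "cover (\<lambda>c. \<exists>i. forces (f i) v c) c" for c v
    by (rule cover_map[OF that(4), where R = "\<lambda>c. idem c \<and> forces \<phi> v c"])
      (use that in \<open>auto intro: idem_plus_boolean forces_mono simp: boolean_def\<close>)
  then show ?case by simp
next
  case (frobenius n \<phi> \<psi>)
  then show ?case by (auto simp: forces_weaken)
qed (auto intro: cover.here simp: forces_one)

end

section \<open>Term algebras and conservativity for regular sequents\<close>

text \<open>
  For an equational theory \<open>T\<close> and a conjunction of equations \<open>\<chi>\<close>, the quotient by these classes is the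
  \<open>T\<close>-algebra presented by \<open>m\<close> generators and the relations \<open>\<chi>\<close>.
\<close>

definition term_class :: "'i geom_theory \<Rightarrow> nat \<Rightarrow> 'i geom_fm \<Rightarrow> mv_term \<Rightarrow> mv_term set" where
  "term_class T m \<chi> t = {s. T \<tturnstile> (\<chi> \<turnstile>[m] Eq s t)}"

lemma term_class_eq_iff:
  assumes "term_in_ctxt m s" "fm_in_ctxt m \<chi>"
  shows "term_class T m \<chi> s = term_class T m \<chi> t \<longleftrightarrow> T \<tturnstile> (\<chi> \<turnstile>[m] Eq s t)"
  using derives_refl[OF assms, of T]
  by (auto simp: term_class_def intro: derives_sym derives_eq_trans)

definition term_rep :: "'i geom_theory \<Rightarrow> nat \<Rightarrow> 'i geom_fm \<Rightarrow> mv_term set \<Rightarrow> mv_term" where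
  "term_rep T m \<chi> X = (SOME t. term_in_ctxt m t \<and> term_class T m \<chi> t = X)"

definition term_algebra :: "'i geom_theory \<Rightarrow> nat \<Rightarrow> 'i geom_fm \<Rightarrow> mv_term set mv_structure" where
  "term_algebra T m \<chi> =
    \<lparr>mv_carrier = term_class T m \<chi> ` {t. term_in_ctxt m t},
     mv_zero = term_class T m \<chi> Zero,
     mv_neg = (\<lambda>X. term_class T m \<chi> (Neg (term_rep T m \<chi> X))),
     mv_plus = (\<lambda>X Y. term_class T m \<chi> (Plus (term_rep T m \<chi> X) (term_rep T m \<chi> Y)))\<rparr>"

lemma term_rep:
  assumes "term_in_ctxt m t" "fm_in_ctxt m \<chi>"
  shows "T \<tturnstile> (\<chi> \<turnstile>[m] Eq (term_rep T m \<chi> (term_class T m \<chi> t)) t)"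
proof -
  let ?r = "term_rep T m \<chi> (term_class T m \<chi> t)"
  have "term_in_ctxt m ?r \<and> term_class T m \<chi> ?r = term_class T m \<chi> t"
    unfolding term_rep_def by (rule someI[where x = t]) (simp add: assms)
  then show ?thesis using term_class_eq_iff assms(2) by blast
qed

lemma term_algebra_simps:
  shows "mv_zero (term_algebra T m \<chi>) = term_class T m \<chi> Zero"
    and "term_in_ctxt m s \<Longrightarrow> fm_in_ctxt m \<chi> \<Longrightarrow>
      mv_neg (term_algebra T m \<chi>) (term_class T m \<chi> s) = term_class T m \<chi> (Neg s)"
    and "term_in_ctxt m s \<Longrightarrow> term_in_ctxt m t \<Longrightarrow> fm_in_ctxt m \<chi> \<Longrightarrow>
      mv_plus (term_algebra T m \<chi>) (term_class T m \<chi> s) (term_class T m \<chi> t) = term_class T m \<chi> (Plus s t)"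
proof -
  show "mv_zero (term_algebra T m \<chi>) = term_class T m \<chi> Zero"
    by (simp add: term_algebra_def)
next
  assume "term_in_ctxt m s" "fm_in_ctxt m \<chi>"
  then have *: "T \<tturnstile> (\<chi> \<turnstile>[m] Eq (Neg (term_rep T m \<chi> (term_class T m \<chi> s))) (Neg s))"
    by (intro derives_neg term_rep)
  then show "mv_neg (term_algebra T m \<chi>) (term_class T m \<chi> s) = term_class T m \<chi> (Neg s)"
    using derives_wf[OF *] by (simp add: term_algebra_def term_class_eq_iff)
next
  assume "term_in_ctxt m s" "term_in_ctxt m t" "fm_in_ctxt m \<chi>"
  then have *: "T \<tturnstile> (\<chi> \<turnstile>[m] Eq (Plus (term_rep T m \<chi> (term_class T m \<chi> s))
      (term_rep T m \<chi> (term_class T m \<chi> t))) (Plus s t))"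
    by (intro derives_plus term_rep)
  then show "mv_plus (term_algebra T m \<chi>) (term_class T m \<chi> s) (term_class T m \<chi> t) = term_class T m \<chi> (Plus s t)"
    using derives_wf[OF *] by (simp add: term_algebra_def term_class_eq_iff)
qed

lemma subst_term_total_ctxt: "(\<And>i. term_in_ctxt m (\<sigma> i)) \<Longrightarrow> term_in_ctxt m (subst_term \<sigma> t)"
  by (induction t) auto

lemma term_algebra_eval:
  assumes "\<And>i. term_in_ctxt m (\<sigma> i)" "fm_in_ctxt m \<chi>"
  shows "mv_eval (term_algebra T m \<chi>) (\<lambda>i. term_class T m \<chi> (\<sigma> i)) t = term_class T m \<chi> (subst_term \<sigma> t)"
proof (induction t)
  case (Neg t)
  then show ?case using assms by (simp add: term_algebra_simps subst_term_total_ctxt)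
next
  case (Plus s t)
  then show ?case using assms by (simp add: term_algebra_simps subst_term_total_ctxt)
qed (simp_all add: term_algebra_simps)

lemma term_algebra_valuation:
  assumes "\<And>i. v i \<in> mv_carrier (term_algebra T m \<chi>)"
  obtains \<sigma> where "\<And>i. term_in_ctxt m (\<sigma> i)" "v = (\<lambda>i. term_class T m \<chi> (\<sigma> i))"
proof -
  have "\<forall>i. \<exists>t. term_in_ctxt m t \<and> v i = term_class T m \<chi> t"
    using assms by (auto simp: term_algebra_def image_iff)
  then obtain \<sigma> where "\<forall>i. term_in_ctxt m (\<sigma> i) \<and> v i = term_class T m \<chi> (\<sigma> i)" by metis
  then show thesis by (intro that) auto
qed

lemma term_algebra_equation:
  assumes "(Top \<turnstile>[k] Eq s t) \<in> T" "term_in_ctxt k s" "term_in_ctxt k t" "fm_in_ctxt m \<chi>"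
    and v: "\<And>i. v i \<in> mv_carrier (term_algebra T m \<chi>)"
  shows "mv_eval (term_algebra T m \<chi>) v s = mv_eval (term_algebra T m \<chi>) v t"
proof -
  from v obtain \<sigma> where \<sigma>: "\<And>i. term_in_ctxt m (\<sigma> i)" "v = (\<lambda>i. term_class T m \<chi> (\<sigma> i))"
    using term_algebra_valuation by blast
  have "T \<tturnstile> (subst_fm \<sigma> Top \<turnstile>[m] subst_fm \<sigma> (Eq s t))"
    by (rule substitution[OF ax[OF assms(1)]]) (use assms \<sigma> in auto)
  then have "T \<tturnstile> (\<chi> \<turnstile>[m] Eq (subst_term \<sigma> s) (subst_term \<sigma> t))"
    using cut[OF top_right] assms(4) by simp
  then show ?thesis
    using \<sigma> assms(4) by (simp add: term_algebra_eval term_class_eq_iff subst_term_total_ctxt)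
qed

lemma term_algebra_mv:
  fixes T :: "'i geom_theory"
  assumes "MV_theory \<subseteq> T" "fm_in_ctxt m \<chi>"
  shows "mv_alg (term_algebra T m \<chi>)"
proof
  let ?A = "term_algebra T m \<chi>"
  have cl: "mv_zero ?A \<in> mv_carrier ?A"
    "\<And>x. x \<in> mv_carrier ?A \<Longrightarrow> mv_neg ?A x \<in> mv_carrier ?A"
    "\<And>x y. x \<in> mv_carrier ?A \<Longrightarrow> y \<in> mv_carrier ?A \<Longrightarrow> mv_plus ?A x y \<in> mv_carrier ?A"
  proof -
    show "mv_zero ?A \<in> mv_carrier ?A"
      by (auto simp: term_algebra_def)
    show "mv_neg ?A x \<in> mv_carrier ?A" if x: "x \<in> mv_carrier ?A" for x
    proof -
      from x obtain t where t: "term_in_ctxt m t" "x = term_class T m \<chi> t"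
        by (auto simp: term_algebra_def)
      then have "mv_neg ?A x = term_class T m \<chi> (Neg t)"
        using assms(2) by (simp add: term_algebra_simps)
      also have "\<dots> \<in> mv_carrier ?A"
        using t by (auto simp: term_algebra_def)
      finally show ?thesis .
    qed
    show "mv_plus ?A x y \<in> mv_carrier ?A" if xy: "x \<in> mv_carrier ?A" "y \<in> mv_carrier ?A" for x y
    proof -
      from xy obtain s t where t: "term_in_ctxt m s" "x = term_class T m \<chi> s"
        "term_in_ctxt m t" "y = term_class T m \<chi> t"
        by (auto simp: term_algebra_def)
      then have "mv_plus ?A x y = term_class T m \<chi> (Plus s t)"
        using assms(2) by (simp add: term_algebra_simps)
      also have "\<dots> \<in> mv_carrier ?A"
        using t by (auto simp: term_algebra_def)
      finally show ?thesis .
    qed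
  qed
  have eq: "mv_eval ?A (case_nat x (case_nat y (\<lambda>_. z))) s = mv_eval ?A (case_nat x (case_nat y (\<lambda>_. z))) t"
    if "(Top \<turnstile>[k] Eq s t :: 'i sequent) \<in> MV_theory" "term_in_ctxt k s" "term_in_ctxt k t"
      "x \<in> mv_carrier ?A" "y \<in> mv_carrier ?A" "z \<in> mv_carrier ?A" for s t k x y z
    using that assms by (intro term_algebra_equation[of k]) (auto split: nat.splits dest: subsetD)
  note eqs = eq[of 3 "Plus (Plus (Var 0) (Var 1)) (Var 2)" "Plus (Var 0) (Plus (Var 1) (Var 2))"]
    eq[of 2 "Plus (Var 0) (Var 1)" "Plus (Var 1) (Var 0)"]
    eq[of 1 "Plus (Var 0) Zero" "Var 0"] eq[of 1 "Neg (Neg (Var 0))" "Var 0"]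
    eq[of 1 "Plus (Var 0) One" One]
    eq[of 2 "Plus (Neg (Plus (Neg (Var 0)) (Var 1))) (Var 1)" "Plus (Neg (Plus (Neg (Var 1)) (Var 0))) (Var 0)"]
  show "mv_algebra ?A"
    unfolding mv_algebra_def
    using cl eqs by (simp add: MV_theory_def Let_def numeral_2_eq_2)
qed

text \<open>
  The regular fragment: equations, finite conjunctions and existential quantification.
\<close>

primrec regular_fm :: "'i geom_fm \<Rightarrow> bool" where
  "regular_fm (Eq s t) \<longleftrightarrow> True"
| "regular_fm Top \<longleftrightarrow> True"
| "regular_fm (And \<phi> \<psi>) \<longleftrightarrow> regular_fm \<phi> \<and> regular_fm \<psi>"
| "regular_fm Bot \<longleftrightarrow> False"
| "regular_fm (Or \<phi> \<psi>) \<longleftrightarrow> False"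
| "regular_fm (Disj f) \<longleftrightarrow> False"
| "regular_fm (Ex \<phi>) \<longleftrightarrow> regular_fm \<phi>"

lemma cartesian_regular: "cartesian_fm T n \<phi> \<Longrightarrow> regular_fm \<phi> \<and> fm_in_ctxt n \<phi>"
  by (induction rule: cartesian_fm.induct) auto

locale mv_theory =
  fixes T :: "'i geom_theory"
  assumes MV: "MV_theory \<subseteq> T"
begin

text \<open>
  Truth of a formula in the term algebra at the tuple of terms \<open>\<sigma>\<close>.  For regular formulae
  it amounts to provability under \<open>\<chi>\<close> with explicit witnessing terms.
\<close>

definition realized :: "nat \<Rightarrow> 'i geom_fm \<Rightarrow> 'i geom_fm \<Rightarrow> (nat \<Rightarrow> mv_term) \<Rightarrow> bool" where
  "realized m \<chi> \<phi> \<sigma> \<longleftrightarrow> mv_alg.forces (term_algebra T m \<chi>) \<phi>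
     (\<lambda>i. term_class T m \<chi> (\<sigma> i)) (mv_zero (term_algebra T m \<chi>))"

lemma realized_simps:
  assumes \<chi>: "fm_in_ctxt m \<chi>" and \<sigma>: "\<And>i. term_in_ctxt m (\<sigma> i)"
  shows "realized m \<chi> (Eq s t) \<sigma> \<longleftrightarrow> T \<tturnstile> (\<chi> \<turnstile>[m] Eq (subst_term \<sigma> s) (subst_term \<sigma> t))"
    and "realized m \<chi> Top \<sigma>"
    and "realized m \<chi> (And \<phi> \<psi>) \<sigma> \<longleftrightarrow> realized m \<chi> \<phi> \<sigma> \<and> realized m \<chi> \<psi> \<sigma>"
    and "realized m \<chi> (Ex \<phi>) \<sigma> \<longleftrightarrow> (\<exists>t. term_in_ctxt m t \<and> realized m \<chi> \<phi> (case_nat t \<sigma>))"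
proof -
  interpret A: mv_alg "term_algebra T m \<chi>"
    using term_algebra_mv[OF MV \<chi>] .
  have car: "mv_carrier (term_algebra T m \<chi>) = term_class T m \<chi> ` {t. term_in_ctxt m t}"
    by (simp add: term_algebra_def)
  have mem: "term_class T m \<chi> (subst_term \<sigma> s) \<in> mv_carrier (term_algebra T m \<chi>)" for s
    using subst_term_total_ctxt[of m \<sigma>] \<sigma> car by auto
  show "realized m \<chi> (Eq s t) \<sigma> \<longleftrightarrow> T \<tturnstile> (\<chi> \<turnstile>[m] Eq (subst_term \<sigma> s) (subst_term \<sigma> t))"
    using mem by (simp add: realized_def A.congr_def term_algebra_eval \<chi> \<sigma>)
      (simp add: term_class_eq_iff \<chi> \<sigma> subst_term_total_ctxt)
  show "realized m \<chi> Top \<sigma>"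
    and "realized m \<chi> (And \<phi> \<psi>) \<sigma> \<longleftrightarrow> realized m \<chi> \<phi> \<sigma> \<and> realized m \<chi> \<psi> \<sigma>"
    by (simp_all add: realized_def)
  have "(\<lambda>i. term_class T m \<chi> (case_nat t \<sigma> i)) = case_nat (term_class T m \<chi> t) (\<lambda>i. term_class T m \<chi> (\<sigma> i))" for t
    by (auto split: nat.splits)
  then show "realized m \<chi> (Ex \<phi>) \<sigma> \<longleftrightarrow> (\<exists>t. term_in_ctxt m t \<and> realized m \<chi> \<phi> (case_nat t \<sigma>))"
    by (auto simp: realized_def car)
qed

lemma realized_derives:
  assumes "regular_fm \<phi>" "fm_in_ctxt n \<phi>" "fm_in_ctxt m \<chi>" "\<And>i. term_in_ctxt m (\<sigma> i)"
    and "realized m \<chi> \<phi> \<sigma>"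
  shows "T \<tturnstile> (\<chi> \<turnstile>[m] subst_fm \<sigma> \<phi>)"
  using assms
proof (induction \<phi> arbitrary: n \<sigma>)
  case (Ex \<phi>)
  then obtain t where t: "term_in_ctxt m t" "realized m \<chi> \<phi> (case_nat t \<sigma>)"
    using realized_simps(4)[of m \<chi> \<sigma> \<phi>] by auto
  have "T \<tturnstile> (\<chi> \<turnstile>[m] subst_fm (case_nat t \<sigma>) \<phi>)"
    by (rule Ex.IH[of "Suc n"]) (use Ex.prems t in \<open>auto split: nat.splits\<close>)
  moreover have "fm_in_ctxt (Suc m) (subst_fm (lift_subst \<sigma>) \<phi>)"
    using subst_fm_ctxt[of n "Ex \<phi>" m \<sigma>] Ex.prems by simp
  ultimately show ?case
    using derives_ex_intro[of T \<chi> m t "subst_fm (lift_subst \<sigma>) \<phi>"] t by (simp add: subst_lift_case)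
qed (auto simp: realized_simps intro: and_right top_right)

text \<open>
  A substitution \<open>\<rho>\<close> under which \<open>\<chi>'\<close> entails \<open>\<chi>\<close> induces a homomorphism of term algebras, and
  homomorphisms preserve regular formulae.
\<close>

lemma realized_mono:
  assumes "regular_fm \<phi>" "fm_in_ctxt m \<chi>" "\<And>i. term_in_ctxt m (\<sigma> i)" "realized m \<chi> \<phi> \<sigma>"
    and \<rho>: "\<And>i. term_in_ctxt m' (\<rho> i)" and \<chi>': "T \<tturnstile> (\<chi>' \<turnstile>[m'] subst_fm \<rho> \<chi>)"
  shows "realized m' \<chi>' \<phi> (\<lambda>i. subst_term \<rho> (\<sigma> i))"
  using assms(1,3,4)
proof (induction \<phi> arbitrary: \<sigma>)
  case (Eq s t)
  have wf: "fm_in_ctxt m' \<chi>'" using derives_wf[OF \<chi>'] by simp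
  have "T \<tturnstile> (\<chi> \<turnstile>[m] Eq (subst_term \<sigma> s) (subst_term \<sigma> t))"
    using Eq assms(2) by (simp add: realized_simps)
  then have "T \<tturnstile> (subst_fm \<rho> \<chi> \<turnstile>[m'] subst_fm \<rho> (Eq (subst_term \<sigma> s) (subst_term \<sigma> t)))"
    by (rule substitution) (rule \<rho>)
  then have "T \<tturnstile> (\<chi>' \<turnstile>[m'] subst_fm \<rho> (Eq (subst_term \<sigma> s) (subst_term \<sigma> t)))"
    by (rule cut[OF \<chi>'])
  then show ?case
    using wf \<rho> Eq by (simp add: realized_simps subst_term_comp subst_term_total_ctxt)
next
  case (Ex \<phi>)
  have wf: "fm_in_ctxt m' \<chi>'" using derives_wf[OF \<chi>'] by simp
  from Ex obtain t where t: "term_in_ctxt m t" "realized m \<chi> \<phi> (case_nat t \<sigma>)"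
    using realized_simps(4)[of m \<chi> \<sigma> \<phi>] assms(2) by auto
  have "realized m' \<chi>' \<phi> (\<lambda>i. subst_term \<rho> (case_nat t \<sigma> i))"
    by (rule Ex.IH) (use Ex.prems t in \<open>auto split: nat.splits\<close>)
  moreover have "(\<lambda>i. subst_term \<rho> (case_nat t \<sigma> i)) = case_nat (subst_term \<rho> t) (\<lambda>i. subst_term \<rho> (\<sigma> i))"
    by (auto split: nat.splits)
  ultimately show ?case
    using wf \<rho> by (auto simp: realized_simps subst_term_total_ctxt intro!: exI[of _ "subst_term \<rho> t"])
next
  case Top
  show ?case using derives_wf[OF \<chi>'] \<rho> by (simp add: realized_simps subst_term_total_ctxt)
next
  case (And \<phi> \<psi>)
  then show ?case
    using derives_wf[OF \<chi>'] \<rho> assms(2) by (simp add: realized_simps subst_term_total_ctxt)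
qed auto

text \<open>
  This replaces a generic model of \<open>\<phi>\<close>: to derive \<open>\<theta>\<close> from \<open>\<chi>\<close> and \<open>\<phi>\<close>, it is enough to derive it
  from every stronger hypothesis, in any context, whose term algebra realizes \<open>\<phi>\<close>.  An equation is
  realized by adding it to the hypothesis, an existential quantifier by adding a variable to the
  context, and a conjunction by doing both extensions in turn.  Quantifying over all extensions
  \<open>\<rho>\<close> and over \<open>\<theta>\<close> spares an induction that tracks the number of new variables.  The substitutions
  are total into the context, so that tuples of terms are valuations in the term algebra.
\<close>

lemma derives_by_realizing:
  assumes "regular_fm \<phi>" "fm_in_ctxt n \<phi>" "fm_in_ctxt m \<chi>" "fm_in_ctxt m \<theta>"
    and "\<And>i. term_in_ctxt m (\<sigma> i)"
    and "\<And>m' \<chi>' \<rho>. (\<And>i. term_in_ctxt m' (\<rho> i)) \<Longrightarrow> T \<tturnstile> (\<chi>' \<turnstile>[m'] subst_fm \<rho> \<chi>) \<Longrightarrow>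
      realized m' \<chi>' \<phi> (\<lambda>i. subst_term \<rho> (\<sigma> i)) \<Longrightarrow> T \<tturnstile> (\<chi>' \<turnstile>[m'] subst_fm \<rho> \<theta>)"
  shows "T \<tturnstile> (And \<chi> (subst_fm \<sigma> \<phi>) \<turnstile>[m] \<theta>)"
  using assms
proof (induction \<phi> arbitrary: n m \<chi> \<sigma> \<theta>)
  case (Eq s t)
  \<comment> \<open>The identity on the context \<open>m\<close>, made total by a closed term.\<close>
  let ?\<rho> = "\<lambda>i. if i < m then Var i else Zero"
  let ?\<chi> = "And \<chi> (subst_fm \<sigma> (Eq s t))"
  have id: "subst_fm ?\<rho> \<chi> = \<chi>" "subst_fm ?\<rho> \<theta> = \<theta>" "\<And>t. term_in_ctxt m t \<Longrightarrow> subst_term ?\<rho> t = t"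
    using Eq.prems by (auto intro: subst_fm_id[of m] subst_term_id[of m])
  have wf: "fm_in_ctxt m (subst_fm \<sigma> (Eq s t))"
    using Eq.prems by (auto intro: subst_term_total_ctxt)
  have "realized m ?\<chi> (Eq s t) \<sigma>"
    using wf Eq.prems and_left2[OF Eq.prems(3) wf, of T] by (simp add: realized_simps)
  then have "T \<tturnstile> (?\<chi> \<turnstile>[m] subst_fm ?\<rho> \<theta>)"
    by (intro Eq.prems(6)) (use Eq.prems wf in \<open>simp_all add: id and_left1\<close>)
  then show ?case by (simp add: id)
next
  case Top
  let ?\<rho> = "\<lambda>i. if i < m then Var i else Zero"
  have id: "subst_fm ?\<rho> \<chi> = \<chi>" "subst_fm ?\<rho> \<theta> = \<theta>"
    using Top.prems by (auto intro: subst_fm_id[of m])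
  have "T \<tturnstile> (\<chi> \<turnstile>[m] subst_fm ?\<rho> \<theta>)"
    by (intro Top.prems(6)) (use Top.prems in \<open>simp_all add: id ident realized_simps subst_term_total_ctxt\<close>)
  then show ?case
    using cut[OF and_left1[of m \<chi> Top T]] Top.prems by (simp add: id)
next
  case (And \<phi> \<psi>)
  have wf: "fm_in_ctxt m (subst_fm \<sigma> \<phi>)" "fm_in_ctxt m (subst_fm \<sigma> \<psi>)"
    using And.prems by (auto intro: subst_fm_ctxt)
  have "T \<tturnstile> (And (And \<chi> (subst_fm \<sigma> \<phi>)) (subst_fm \<sigma> \<psi>) \<turnstile>[m] \<theta>)"
  proof (rule And.IH(2)[of n])
    fix m1 \<chi>1 \<rho>1
    assume \<rho>1: "\<And>i. term_in_ctxt m1 (\<rho>1 i)"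
      and \<chi>1: "T \<tturnstile> (\<chi>1 \<turnstile>[m1] subst_fm \<rho>1 (And \<chi> (subst_fm \<sigma> \<phi>)))"
      and re1: "realized m1 \<chi>1 \<psi> (\<lambda>i. subst_term \<rho>1 (\<sigma> i))"
    have wf1: "fm_in_ctxt m1 \<chi>1" "fm_in_ctxt m1 (subst_fm \<rho>1 \<chi>)" "fm_in_ctxt m1 (subst_fm \<rho>1 (subst_fm \<sigma> \<phi>))"
      using derives_wf[OF \<chi>1] by auto
    have d1: "T \<tturnstile> (\<chi>1 \<turnstile>[m1] subst_fm \<rho>1 \<chi>)" "T \<tturnstile> (\<chi>1 \<turnstile>[m1] subst_fm \<rho>1 (subst_fm \<sigma> \<phi>))"
      using cut[OF \<chi>1[simplified] and_left1] cut[OF \<chi>1[simplified] and_left2] wf1 by auto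
    have "T \<tturnstile> (And \<chi>1 (subst_fm (\<lambda>i. subst_term \<rho>1 (\<sigma> i)) \<phi>) \<turnstile>[m1] subst_fm \<rho>1 \<theta>)"
    proof (rule And.IH(1)[of n])
      fix m2 \<chi>2 \<rho>2
      assume \<rho>2: "\<And>i. term_in_ctxt m2 (\<rho>2 i)"
        and \<chi>2: "T \<tturnstile> (\<chi>2 \<turnstile>[m2] subst_fm \<rho>2 \<chi>1)"
        and re2: "realized m2 \<chi>2 \<phi> (\<lambda>i. subst_term \<rho>2 (subst_term \<rho>1 (\<sigma> i)))"
      let ?\<rho> = "\<lambda>i. subst_term \<rho>2 (\<rho>1 i)"
      have "T \<tturnstile> (subst_fm \<rho>2 \<chi>1 \<turnstile>[m2] subst_fm \<rho>2 (subst_fm \<rho>1 \<chi>))"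
        by (rule substitution[OF d1(1)]) (rule \<rho>2)
      then have "T \<tturnstile> (\<chi>2 \<turnstile>[m2] subst_fm ?\<rho> \<chi>)"
        using cut[OF \<chi>2] by (simp add: subst_fm_comp)
      moreover have "realized m2 \<chi>2 \<psi> (\<lambda>i. subst_term \<rho>2 (subst_term \<rho>1 (\<sigma> i)))"
        by (rule realized_mono[OF _ wf1(1) _ re1 _ \<chi>2])
          (use And.prems \<rho>1 \<rho>2 in \<open>auto intro: subst_term_total_ctxt\<close>)
      moreover have "fm_in_ctxt m2 \<chi>2" using derives_wf[OF \<chi>2] by simp
      ultimately have "T \<tturnstile> (\<chi>2 \<turnstile>[m2] subst_fm ?\<rho> \<theta>)"
        using re2 \<rho>1 \<rho>2
        by (intro And.prems(6)) (simp_all add: subst_term_comp realized_simps subst_term_total_ctxt)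
      then show "T \<tturnstile> (\<chi>2 \<turnstile>[m2] subst_fm \<rho>2 (subst_fm \<rho>1 \<theta>))"
        by (simp add: subst_fm_comp)
    qed (use And.prems \<rho>1 wf1 in \<open>auto intro: subst_term_total_ctxt subst_fm_ctxt\<close>)
    moreover have "T \<tturnstile> (\<chi>1 \<turnstile>[m1] And \<chi>1 (subst_fm (\<lambda>i. subst_term \<rho>1 (\<sigma> i)) \<phi>))"
      using d1(2) wf1 by (intro and_right ident) (auto simp: subst_fm_comp)
    ultimately show "T \<tturnstile> (\<chi>1 \<turnstile>[m1] subst_fm \<rho>1 \<theta>)"
      by (rule cut[rotated])
  qed (use And.prems wf in auto)
  moreover have "T \<tturnstile> (And \<chi> (And (subst_fm \<sigma> \<phi>) (subst_fm \<sigma> \<psi>)) \<turnstile>[m]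
      And (And \<chi> (subst_fm \<sigma> \<phi>)) (subst_fm \<sigma> \<psi>))"
    using wf And.prems(3)
    by (intro and_right cut[OF and_left2 and_left1] cut[OF and_left2 and_left2] and_left1) auto
  ultimately show ?case by (auto intro: cut)
next
  case (Ex \<phi>)
  have wf: "fm_in_ctxt (Suc m) (subst_fm (lift_subst \<sigma>) \<phi>)"
    using subst_fm_ctxt[of n "Ex \<phi>" m \<sigma>] Ex.prems by simp
  have lift: "term_in_ctxt (Suc m) (lift_subst \<sigma> i)" for i
    using Ex.prems(5) by (cases i) (auto simp: shift_term_ctxt)
  have "T \<tturnstile> (And (weaken_fm \<chi>) (subst_fm (lift_subst \<sigma>) \<phi>) \<turnstile>[Suc m] weaken_fm \<theta>)"
  proof (rule Ex.IH[of "Suc n"])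
    fix m' \<chi>' \<rho>
    assume \<rho>: "\<And>i. term_in_ctxt m' (\<rho> i)"
      and \<chi>': "T \<tturnstile> (\<chi>' \<turnstile>[m'] subst_fm \<rho> (weaken_fm \<chi>))"
      and re: "realized m' \<chi>' \<phi> (\<lambda>i. subst_term \<rho> (lift_subst \<sigma> i))"
    have wf': "fm_in_ctxt m' \<chi>'" using derives_wf[OF \<chi>'] by simp
    have "(\<lambda>i. subst_term \<rho> (lift_subst \<sigma> i)) =
        case_nat (\<rho> 0) (\<lambda>i. subst_term (\<lambda>i. \<rho> (Suc i)) (\<sigma> i))"
      by (auto simp: fun_eq_iff subst_term_comp split: nat.splits)
    then have "realized m' \<chi>' (Ex \<phi>) (\<lambda>i. subst_term (\<lambda>i. \<rho> (Suc i)) (\<sigma> i))"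
      using re \<rho> wf' by (auto simp: realized_simps subst_term_total_ctxt)
    then show "T \<tturnstile> (\<chi>' \<turnstile>[m'] subst_fm \<rho> (weaken_fm \<theta>))"
      using Ex.prems(6)[of m' "\<lambda>i. \<rho> (Suc i)" \<chi>'] \<chi>' \<rho> by (simp add: subst_weaken)
  qed (use Ex.prems lift in \<open>auto intro: weaken_fm_ctxt\<close>)
  then have "T \<tturnstile> (Ex (And (weaken_fm \<chi>) (subst_fm (lift_subst \<sigma>) \<phi>)) \<turnstile>[m] \<theta>)"
    using Ex.prems(4) by (rule ex_left)
  then show ?case
    using cut[OF frobenius[OF Ex.prems(3) wf]] by simp
qed auto

text \<open>
  Whenever a term algebra realizes \<open>\<phi>\<close>, soundness of forcing at the world \<open>\<zero>\<close> makes it realize \<open>\<psi>\<close>,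
  with witnesses that are terms, which is a derivation of \<open>\<psi>\<close> in \<open>T\<close>.
\<close>

theorem regular_conservativity:
  assumes valid: "\<And>m \<chi> s. fm_in_ctxt m \<chi> \<Longrightarrow> s \<in> T' \<Longrightarrow> mv_alg.valid (term_algebra T m \<chi>) s"
    and d: "T' \<tturnstile> (\<phi> \<turnstile>[n] \<psi>)" and reg: "regular_fm \<phi>" "regular_fm \<psi>"
  shows "T \<tturnstile> (\<phi> \<turnstile>[n] \<psi>)"
proof -
  \<comment> \<open>The identity on the context \<open>n\<close>, made total by a closed term.\<close>
  let ?\<sigma> = "\<lambda>i. if i < n then Var i else Zero"
  have wf: "fm_in_ctxt n \<phi>" "fm_in_ctxt n \<psi>" using derives_wf[OF d] by auto
  have id: "subst_fm ?\<sigma> \<phi> = \<phi>" "subst_fm ?\<sigma> \<psi> = \<psi>"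
    using wf by (auto intro: subst_fm_id[of n])
  have "T \<tturnstile> (And Top (subst_fm ?\<sigma> \<phi>) \<turnstile>[n] \<psi>)"
  proof (rule derives_by_realizing[OF reg(1) wf(1)])
    fix m \<chi> \<rho>
    assume \<rho>: "\<And>i. term_in_ctxt m (\<rho> i)" and \<chi>: "T \<tturnstile> (\<chi> \<turnstile>[m] subst_fm \<rho> Top)"
      and re: "realized m \<chi> \<phi> (\<lambda>i. subst_term \<rho> (?\<sigma> i))"
    have wf': "fm_in_ctxt m \<chi>" using derives_wf[OF \<chi>] by simp
    interpret A: mv_alg "term_algebra T m \<chi>"
      using term_algebra_mv[OF MV wf'] .
    have total: "term_in_ctxt m (subst_term \<rho> (?\<sigma> i))" for i
      by (rule subst_term_total_ctxt) (rule \<rho>)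
    have "A.valuation (\<lambda>i. term_class T m \<chi> (subst_term \<rho> (?\<sigma> i)))"
      unfolding A.valuation_def using total by (auto simp: term_algebra_def)
    then have "realized m \<chi> \<psi> (\<lambda>i. subst_term \<rho> (?\<sigma> i))"
      using A.derives_valid[OF valid[OF wf'] d] re by (simp add: realized_def)
    then have "T \<tturnstile> (\<chi> \<turnstile>[m] subst_fm (\<lambda>i. subst_term \<rho> (?\<sigma> i)) \<psi>)"
      by (rule realized_derives[OF reg(2) wf(2) wf' total])
    then have "T \<tturnstile> (\<chi> \<turnstile>[m] subst_fm \<rho> (subst_fm ?\<sigma> \<psi>))"
      by (simp only: subst_fm_comp)
    then show "T \<tturnstile> (\<chi> \<turnstile>[m] subst_fm \<rho> \<psi>)"
      by (simp only: id)
  qed (use wf in auto)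
  moreover have "T \<tturnstile> (\<phi> \<turnstile>[n] And Top \<phi>)"
    using wf by (intro and_right top_right ident)
  ultimately show ?thesis by (auto simp: id intro: cut)
qed

end


section \<open>The local theory of a Komori variety\<close>

context mv_alg
begin

lemma eval_multiple: "valuation v \<Longrightarrow> mv_eval A v (multiple k t) = mult k (mv_eval A v t)"
  by (induction k) auto

lemma eval_power: "valuation v \<Longrightarrow> mv_eval A v (power_term t k) = \<sim>(mult k (\<sim>(mv_eval A v t)))"
  by (induction k) (auto simp: Times_def)

text \<open>
  With \<open>a = (n + 1)x\<close> and \<open>e = 2(\<not>a)\<close>, the complement of \<open>a\<^sup>2\<close>, the sequent \<open>\<sigma>\<^sub>n\<close> is forced by splitting
  along the Boolean element \<open>e\<close>: modulo \<open>e\<close> also \<open>\<not>a\<close> vanishes, and modulo \<open>\<sim>e\<close> the square \<open>a\<^sup>2 = \<sim>e\<close>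
  vanishes.
\<close>

lemma Loc1_theory_valid:
  assumes eqs: "\<And>k s t v. (Top \<turnstile>[k] Eq s t :: 'i sequent) \<in> TV_theory I J \<Longrightarrow> valuation v \<Longrightarrow>
      mv_eval A v s = mv_eval A v t"
    and s: "s \<in> (Loc1_theory I J :: 'i geom_theory)"
  shows "valid s"
proof -
  let ?n = "Lcm (I \<union> J)"
  consider (TV) "s \<in> TV_theory I J"
    | (sigma) "s = (Top \<turnstile>[1] Or (Eq (power_term (multiple (?n + 1) (Var 0)) 2) Zero)
        (Eq (multiple (?n + 1) (Var 0)) One))"
    | (nontrivial) "s = (Eq Zero One \<turnstile>[0] Bot)"
    using s by (auto simp: Loc1_theory_def Let_def)
  then show ?thesis
  proof cases
    case TV
    then obtain k a b where "s = (Top \<turnstile>[k] Eq a b)"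
      by (auto simp: TV_theory_def MV_theory_def Let_def)
    then show ?thesis using TV eqs by simp
  next
    case nontrivial
    then show ?thesis by (auto simp: congr_def)
  next
    case sigma
    have "forces (Or (Eq (power_term (multiple (?n + 1) (Var 0)) 2) Zero)
        (Eq (multiple (?n + 1) (Var 0)) One)) v c" if c: "idem c" and v: "valuation v" for c v
    proof -
      define x where "x = v 0"
      define a where "a = mult (?n + 1) x"
      define e where "e = mult 2 (\<sim>a)"
      have x: "x \<in> carr" using v by (simp add: x_def valuation_def)
      then have car: "a \<in> carr" "e \<in> carr" "c \<in> carr" using c by (simp_all add: a_def e_def)
      have v': "valuation (v(0 := \<sim>x))" using v x by (simp add: valuation_def)
      have "(Top \<turnstile>[1] Eq (power_term (multiple (?n + 1) (power_term (Var 0) ?n)) 2)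
          (multiple 2 (power_term (Var 0) (?n + 1))) :: 'i sequent) \<in> TV_theory I J"
        by (simp add: TV_theory_def Let_def)
      \<comment> \<open>The axiom is evaluated at \<open>\<sim>x\<close>, where its powers become negated multiples of \<open>x\<close>.\<close>
      from eqs[OF this v'] have "boolean e"
        unfolding e_def a_def
        by (intro boolean_of_axiom[OF x, of _ ?n])
          (use x v' in \<open>simp_all add: eval_multiple eval_power del: mult.simps multiple.simps power_term.simps\<close>)
      then have "boolean (\<sim>e)" by (rule boolean_neg)
      have "cover (\<lambda>c. congr c (\<sim>e) \<zero> \<or> congr c a \<one>) c"
      proof (rule cover.split[OF \<open>boolean e\<close>])
        have "congr (c \<oplus> e) a \<one>"
          using car by (simp add: congr_def e_def mult_two plus_left_comm[of c])
        then show "cover (\<lambda>c. congr c (\<sim>e) \<zero> \<or> congr c a \<one>) (c \<oplus> e)"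
          by (intro cover.here) simp
        have "idem (\<sim>e)" using \<open>boolean e\<close> by (simp add: boolean_def)
        then have "congr (c \<oplus> \<sim>e) (\<sim>e) \<zero>"
          using car by (simp add: congr_def plus_left_comm[of _ c])
        then show "cover (\<lambda>c. congr c (\<sim>e) \<zero> \<or> congr c a \<one>) (c \<oplus> \<sim>e)"
          by (intro cover.here) simp
      qed
      then show ?thesis
        using v x by (simp add: eval_multiple eval_power a_def e_def x_def del: mult.simps multiple.simps)
    qed
    then show ?thesis unfolding sigma by simp
  qed
qed

end

lemma multiple_ctxt [simp]: "term_in_ctxt n t \<Longrightarrow> term_in_ctxt n (multiple k t)"
  by (induction k) auto

lemma power_term_ctxt [simp]: "term_in_ctxt n t \<Longrightarrow> term_in_ctxt n (power_term t k)"
  by (induction k) (auto simp: Times_def)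

lemma TV_theory_wf:
  "s \<in> TV_theory I J \<Longrightarrow> \<exists>k a b. s = (Top \<turnstile>[k] Eq a b) \<and> term_in_ctxt k a \<and> term_in_ctxt k b"
  unfolding TV_theory_def MV_theory_def Let_def
  by (auto simp del: multiple.simps power_term.simps)

theorem proposition5p6:
  fixes V :: "'a mv_structure set" and I J :: "nat set"
  assumes "finite I" and "finite J" and "I \<union> J \<noteq> {}" and "\<forall>k\<in>I \<union> J. 0 < k"
    and "V = Komori_variety I J"
  shows "theory_equiv (cartesianization (Loc1_theory I J :: 'i geom_theory)) (TV_theory I J)"
proof -
  interpret mv_theory "TV_theory I J :: 'i geom_theory"
    by standard (auto simp: TV_theory_def Let_def)
  have valid: "mv_alg.valid (term_algebra (TV_theory I J) m \<chi>) s"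
    if \<chi>: "fm_in_ctxt m \<chi>" and s: "s \<in> Loc1_theory I J" for m and \<chi> :: "'i geom_fm" and s :: "'i sequent"
  proof -
    interpret A: mv_alg "term_algebra (TV_theory I J) m \<chi>"
      using term_algebra_mv[OF MV \<chi>] .
    show ?thesis
    proof (rule A.Loc1_theory_valid[OF _ s])
      fix k s t v
      assume ax: "(Top \<turnstile>[k] Eq s t) \<in> (TV_theory I J :: 'i geom_theory)" and v: "A.valuation v"
      show "mv_eval (term_algebra (TV_theory I J) m \<chi>) v s = mv_eval (term_algebra (TV_theory I J) m \<chi>) v t"
        by (rule term_algebra_equation[OF ax _ _ \<chi>])
          (use TV_theory_wf[OF ax] v in \<open>auto simp: A.valuation_def\<close>)
    qed
  qed
  have "TV_theory I J \<tturnstile> s" if "s \<in> cartesianization (Loc1_theory I J)" for s :: "'i sequent"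
  proof (cases s)
    case (Sequent \<phi> n \<psi>)
    then show ?thesis
      using that regular_conservativity[of "Loc1_theory I J", OF valid]
      by (auto simp: cartesianization_def dest!: cartesian_regular)
  qed
  moreover have "cartesianization (Loc1_theory I J) \<tturnstile> s" if s: "s \<in> TV_theory I J" for s :: "'i sequent"
  proof (rule ax)
    obtain k a b where s': "s = (Top \<turnstile>[k] Eq a b)" "term_in_ctxt k a" "term_in_ctxt k b"
      using TV_theory_wf[OF s] by blast
    show wf: "sequent_wf s" using s' by simp
    have "Loc1_theory I J \<tturnstile> s"
      by (rule derives.ax) (use s wf in \<open>auto simp: Loc1_theory_def Let_def\<close>)
    then show "s \<in> cartesianization (Loc1_theory I J)"
      using s' by (auto simp: cartesianization_def intro: cartesian_fm.intros)
  qed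
  ultimately show ?thesis
    unfolding theory_equiv_def by (blast intro: derives_trans)
qed

end
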